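(* Let $K_1,K_2$ be finite abstract simplicial complexes with weight functions $w_{K_1},w_{K_2}$, and let $p:\{-1,0,\dots,\dim K_1\}\to\mathbb{R}^+$ and $q:\{-1,0,\dots,\dim K_2\}\to\mathbb{R}^+$ be positive functions. Equip the join $K_1*K_2$ with the weight function $$w(F_1*F_2)=p(\dim F_1)\,w_{K_1}(F_1)\,q(\dim F_2)\,w_{K_2}(F_2),\qquad F_1\in K_1,\ F_2\in K_2.$$ Then, up to the multiplicity of the eigenvalue zero, the multiset of eigenvalues of $\mathcal{L}_i(K_1*K_2,w)=\delta_i^*\delta_i+\delta_{i-1}\delta_{i-1}^*$ equals the multiset $$\bigcup_{\substack{i_1+i_2+1=i}}\ \ \bigcup_{\substack{\lambda\in \mathbf{s}(\mathcal{L}_{i_1}(K_1,w_{K_1}))\\ \mu\in\mathbf{s}(\mathcal{L}_{i_2}(K_2,w_{K_2}))}}\bigl\{P_\lambda\lambda+Q_\mu\mu\bigr\},$$ where $i_1,i_2\ge-1$, unions are multiset unions (multiplicities added), and $$P_\lambda=\begin{cases}p(i_1+1)/p(i_1)&\text{if }\lambda\in\mathbf{s}(\mathcal{L}_{i_1}^{up}(K_1)),\\ p(i_1)/p(i_1-1)&\text{if }\lambda\in\mathbf{s}(\mathcal{L}_{i_1}^{down}(K_1)),\end{cases}\qquad Q_\mu=\begin{cases}q(i_2+1)/q(i_2)&\text{if }\mu\in\mathbf{s}(\mathcal{L}_{i_2}^{up}(K_2)),\\ q(i_2)/q(i_2-1)&\text{if }\mu\in\mathbf{s}(\mathcal{L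}_{i_2}^{down}(K_2)).\end{cases}$$
   Context: For a finite abstract simplicial complex $K$ (closed under inclusion, containing the empty face, of dimension $-1$), $S_i(K)$ is the set of $i$-faces and $C^i(K,\mathbb{R})$, $i\ge-1$, is the space of real functions on oriented $i$-faces that change sign when the orientation is reversed. The coboundary $\delta_i:C^i\to C^{i+1}$ is $(\delta_i f)([v_0,\dots,v_{i+1}])=\sum_{j}(-1)^j f([v_0,\dots,\hat v_j,\dots,v_{i+1}])$ ($\delta_{-2}=0$). A weight function assigns a positive real $w(F)$ to each face and defines inner products $(f,g)_{C^i}=\sum_{F\in S_i(K)}w(F)f([F])g([F])$, with adjoints $\delta_i^*$. Define $\mathcal{L}_i^{up}=\delta_i^*\delta_i$, $\mathcal{L}_i^{down}=\delta_{i-1}\delta_{i-1}^*$, $\mathcal{L}_i=\mathcal{L}_i^{up}+\mathcal{L}_i^{down}$ on $C^i$. $\mathbf{s}(A)$ is the multiset of eigenvalues of $A$. The multiset of non-zero eigenvalues of $\mathcal{L}_{i}$ is the multiset union of the non-zero eigenvalues of $\mathcal{L}_i^{up}$ and those of $\mathcal{L}_i^{down}$; each non-zero eigenvalue (counted with multiplicity) is regarded as coming from one of the two, and $P_\lambda$, $Q_\mu$ are chosen accordingly. For $\lambda=0$ (resp. $\mu=0$) the term $P_\lambda\lambda$ (resp. $Q_\mu\mu$) is $0$. The join $K_1*K_2$ is the complex on the disjoint union of the vertex sets whose faces are $F_1*F_2:=F_1\sqcup F_2$ with $F_1\in K_1$, $F_2\in K_2$ (empty faces allowed). *)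

theory Defs
  imports Complex_Main "HOL-Library.Multiset" "HOL-Library.Function_Algebras"
    "HOL-Combinatorics.Permutations"
begin

instantiation "fun" :: (type, real_vector) real_vector
begin

definition "scaleR c f = (\<lambda>x. c *\<^sub>R f x)"

instance
  by standard (simp_all add: scaleR_fun_def plus_fun_def fun_eq_iff algebra_simps)

end

definition abstract_complex :: "'a set set \<Rightarrow> bool" where
  "abstract_complex K \<longleftrightarrow>
     finite K \<and> (\<forall>F\<in>K. finite F) \<and> {} \<in> K \<and> (\<forall>F\<in>K. \<forall>G. G \<subseteq> F \<longrightarrow> G \<in> K)"

definition face_dim :: "'a set \<Rightarrow> int" where
  "face_dim F = int (card F) - 1"

definition complex_dim :: "'a set set \<Rightarrow> int" where
  "complex_dim K = Max (face_dim ` K)"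

definition faces :: "'a set set \<Rightarrow> int \<Rightarrow> 'a set set" where
  "faces K i = {F \<in> K. face_dim F = i}"

definition weight_function :: "'a set set \<Rightarrow> ('a set \<Rightarrow> real) \<Rightarrow> bool" where
  "weight_function K w \<longleftrightarrow> (\<forall>F\<in>K. 0 < w F)"

definition simplicial_join :: "'a set set \<Rightarrow> 'b set set \<Rightarrow> ('a + 'b) set set" where
  "simplicial_join K1 K2 = {F1 <+> F2 | F1 F2. F1 \<in> K1 \<and> F2 \<in> K2}"

definition ordered_faces :: "'a set set \<Rightarrow> int \<Rightarrow> 'a list set" where
  "ordered_faces K i = {vs. distinct vs \<and> set vs \<in> faces K i}"

text \<open>
  An oriented face $[v_0,\dots,v_i]$ is represented by any of its orderings, a list. Two orderings
  represent the same oriented face iff they differ by an even permutation, and opposite ones iff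
  they differ by an odd permutation. A real function on oriented faces changing sign under reversal
  of the orientation is therefore an alternating function of the ordering. It is taken to
  be 0 on all other lists, so that equality of cochains is equality of functions.
\<close>

definition cochains :: "'a set set \<Rightarrow> int \<Rightarrow> ('a list \<Rightarrow> real) set" where
  "cochains K i =
     {f. (\<forall>vs. vs \<notin> ordered_faces K i \<longrightarrow> f vs = 0) \<and>
         (\<forall>vs\<in>ordered_faces K i. \<forall>\<pi>. \<pi> permutes {..<length vs} \<longrightarrow>
            f (permute_list \<pi> vs) = of_int (sign \<pi>) * f vs)}"

text \<open>
  The index \<open>i\<close> is an arbitrary integer. There are no faces of dimension \<open>-2\<close>, so
  \<open>cochains K (-2)\<close> is the zero space and the map out of it is zero.
\<close>

definition coboundary :: "'a set set \<Rightarrow> int \<Rightarrow> ('a list \<Rightarrow> real) \<Rightarrow> 'a list \<Rightarrow> real" where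
  "coboundary K i f =
     (\<lambda>vs. if vs \<in> ordered_faces K (i + 1)
           then \<Sum>j<length vs. (-1) ^ j * f (take j vs @ drop (Suc j) vs)
           else 0)"

text \<open>
  A fixed but arbitrary orientation of a face; a product of two cochains does not depend on it.
\<close>

definition orient :: "'a set \<Rightarrow> 'a list" where
  "orient F = (SOME vs. distinct vs \<and> set vs = F)"

definition cochain_inner ::
  "'a set set \<Rightarrow> ('a set \<Rightarrow> real) \<Rightarrow> int \<Rightarrow> ('a list \<Rightarrow> real) \<Rightarrow> ('a list \<Rightarrow> real) \<Rightarrow> real" where
  "cochain_inner K w i f g = (\<Sum>F\<in>faces K i. w F * f (orient F) * g (orient F))"

text \<open>The adjoint of \<open>coboundary K i\<close>, a map from \<open>cochains K (i + 1)\<close> to \<open>cochains K i\<close>.\<close>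

definition coboundary_adjoint ::
  "'a set set \<Rightarrow> ('a set \<Rightarrow> real) \<Rightarrow> int \<Rightarrow> ('a list \<Rightarrow> real) \<Rightarrow> 'a list \<Rightarrow> real" where
  "coboundary_adjoint K w i g =
     (THE h. h \<in> cochains K i \<and>
        (\<forall>f\<in>cochains K i.
           cochain_inner K w (i + 1) (coboundary K i f) g = cochain_inner K w i f h))"

definition lap_up ::
  "'a set set \<Rightarrow> ('a set \<Rightarrow> real) \<Rightarrow> int \<Rightarrow> ('a list \<Rightarrow> real) \<Rightarrow> 'a list \<Rightarrow> real" where
  "lap_up K w i f = coboundary_adjoint K w i (coboundary K i f)"

definition lap_down ::
  "'a set set \<Rightarrow> ('a set \<Rightarrow> real) \<Rightarrow> int \<Rightarrow> ('a list \<Rightarrow> real) \<Rightarrow> 'a list \<Rightarrow> real" where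
  "lap_down K w i f = coboundary K (i - 1) (coboundary_adjoint K w (i - 1) f)"

definition laplacian ::
  "'a set set \<Rightarrow> ('a set \<Rightarrow> real) \<Rightarrow> int \<Rightarrow> ('a list \<Rightarrow> real) \<Rightarrow> 'a list \<Rightarrow> real" where
  "laplacian K w i f = lap_up K w i f + lap_down K w i f"

definition eigenspace_on :: "'v::real_vector set \<Rightarrow> ('v \<Rightarrow> 'v) \<Rightarrow> real \<Rightarrow> 'v set" where
  "eigenspace_on V A l = {f \<in> V. A f = l *\<^sub>R f}"

text \<open>
  The multiset of real eigenvalues of \<open>A\<close> on the space \<open>V\<close>, each repeated according to the dimension
  of its eigenspace. All operators considered here are self-adjoint on finite-dimensional
  spaces, so there is no difference to the algebraic multiplicity and all eigenvalues are real.
\<close>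

definition eigenvalue_mset :: "'v::real_vector set \<Rightarrow> ('v \<Rightarrow> 'v) \<Rightarrow> real multiset" where
  "eigenvalue_mset V A =
     (\<Sum>l\<in>{l. \<exists>f\<in>eigenspace_on V A l. f \<noteq> 0}.
        replicate_mset (real_vector.dim (eigenspace_on V A l)) l)"

definition lap_eigs :: "'a set set \<Rightarrow> ('a set \<Rightarrow> real) \<Rightarrow> int \<Rightarrow> real multiset" where
  "lap_eigs K w i = eigenvalue_mset (cochains K i) (laplacian K w i)"

definition lap_up_eigs :: "'a set set \<Rightarrow> ('a set \<Rightarrow> real) \<Rightarrow> int \<Rightarrow> real multiset" where
  "lap_up_eigs K w i = eigenvalue_mset (cochains K i) (lap_up K w i)"

definition lap_down_eigs :: "'a set set \<Rightarrow> ('a set \<Rightarrow> real) \<Rightarrow> int \<Rightarrow> real multiset" where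
  "lap_down_eigs K w i = eigenvalue_mset (cochains K i) (lap_down K w i)"

text \<open>
  The eigenvalues \<open>\<lambda>\<close> of the Laplacian with multiplicity, each paired with its factor \<open>P\<^sub>\<lambda>\<close>. The
  nonzero ones are the nonzero eigenvalues of the up-Laplacian together with those of the
  down-Laplacian, and the factor records from which of the two an occurrence comes. An occurrence
  of 0 has no such origin; its factor is irrelevant because only the product of factor and
  eigenvalue matters, and is set to 1.
\<close>

definition factored_eigs ::
  "(int \<Rightarrow> real) \<Rightarrow> 'a set set \<Rightarrow> ('a set \<Rightarrow> real) \<Rightarrow> int \<Rightarrow> (real \<times> real) multiset" where
  "factored_eigs p K w i =
     {#(l, p (i + 1) / p i). l \<in># filter_mset (\<lambda>x. x \<noteq> 0) (lap_up_eigs K w i)#} +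
     {#(l, p i / p (i - 1)). l \<in># filter_mset (\<lambda>x. x \<noteq> 0) (lap_down_eigs K w i)#} +
     {#(l, 1). l \<in># filter_mset (\<lambda>x. x = 0) (lap_eigs K w i)#}"

end

theory Submission
  imports Defs "HOL-Computational_Algebra.Fundamental_Theorem_Algebra"
begin

text \<open>
  Since the coboundary squares to zero, the up- and the down-Laplacian are self-adjoint operators
  whose products vanish, so each cochain space has a basis of common eigenvectors, and each basis
  vector has a nonzero eigenvalue for at most one of the two. On a product
  \<open>\<phi> \<otimes> \<psi>\<close> of cochains of degrees \<open>i\<^sub>1\<close> and \<open>i\<^sub>2\<close> the coboundary of the join obeys the Leibniz
  rule. So does its adjoint, except that the two terms are multiplied by \<open>p(i\<^sub>1) / p(i\<^sub>1 - 1)\<close> and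
  \<open>q(i\<^sub>2) / q(i\<^sub>2 - 1)\<close>. The mixed terms in the Laplacian of the join cancel, hence the products of
  basis vectors of the two factors form an eigenbasis for the join.
\<close>

subsection \<open>Commuting self-adjoint operators\<close>

text \<open>A product of alternating functions of orderings would need signed shuffles. Therefore
  vertices are ranked and a cochain is replaced by its values on increasingly ordered faces. In the
  join all vertices of \<open>K1\<close> rank below those of \<open>K2\<close>, so a product of
  cochains is a plain product of values, and the only sign left is -1 to the number of vertices of
  the \<open>K1\<close> part. The quotients come from the weight. The adjoint contains w(insert v F)
  / w(F); a vertex inserted on the \<open>K1\<close> side leaves the \<open>q\<close> and
  \<open>w2\<close> factors unchanged and contributes a quotient of consecutive values of
  \<open>p\<close>. In the up-Laplacian the adjoint acts in degree i1 + 1, in the down-Laplacian in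
  degree i1, whence the two cases of P. The mixed terms carry equal quotients in both Laplacians,
  because a coboundary on one factor keeps the degree in the other. Positivity of \<open>p\<close>
  and \<open>q\<close> is known only in the dimensions of the complexes; a quotient that leaves this
  range multiplies a zero cochain. An eigenvalue multiset counts dimensions of eigenspaces, so any
  basis of eigenvectors determines it; orthogonality of the products serves to prove their
  independence.\<close>

definition poly_map :: "('v::real_vector \<Rightarrow> 'v) \<Rightarrow> real poly \<Rightarrow> 'v \<Rightarrow> 'v" where
  "poly_map A p v = fold_coeffs (\<lambda>a u. a *\<^sub>R v + A u) p 0"

lemma poly_map_0 [simp]: "poly_map A 0 v = 0"
  by (simp add: poly_map_def)

text \<open>Horner's rule. The coefficient list of the zero polynomial is empty, so the case of
  \<open>pCons 0 0\<close> rests on \<open>A 0 = 0\<close>.\<close>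

lemma poly_map_pCons [simp]:
  assumes "linear A"
  shows "poly_map A (pCons a p) v = a *\<^sub>R v + A (poly_map A p v)"
  by (cases "a = 0 \<and> p = 0") (auto simp: poly_map_def linear_0[OF assms])

lemma poly_map_add:
  assumes "linear A"
  shows "poly_map A (p + q) v = poly_map A p v + poly_map A q v"
  by (induction p q rule: poly_induct2)
     (simp_all add: assms linear_add[OF assms] scaleR_add_left add_ac)

lemma poly_map_smult:
  assumes "linear A"
  shows "poly_map A (smult c p) v = c *\<^sub>R poly_map A p v"
  by (induction p) (simp_all add: assms linear_scale[OF assms] scaleR_add_right)

lemma poly_map_mult:
  assumes "linear A"
  shows "poly_map A (p * q) v = poly_map A p (poly_map A q v)"
  by (induction p) (simp_all add: assms poly_map_add poly_map_smult)

lemma poly_map_monom: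
  assumes "linear A"
  shows "poly_map A (monom c n) v = c *\<^sub>R (A ^^ n) v"
  by (induction n)
     (simp_all add: assms monom_0 monom_Suc linear_scale[OF assms] linear_0[OF assms])

lemma poly_map_sum:
  assumes "linear A"
  shows "poly_map A (\<Sum>i\<in>I. f i) v = (\<Sum>i\<in>I. poly_map A (f i) v)"
  by (induction I rule: infinite_finite_induct) (simp_all add: assms poly_map_add)

lemma poly_map_closed:
  assumes "linear A" "subspace V" "A ` V \<subseteq> V" "v \<in> V"
  shows "poly_map A p v \<in> V"
  using assms
  by (induction p) (auto simp: subspace_0 subspace_add subspace_scale image_subset_iff)

text \<open>The \<open>card S + 1\<close> vectors v, A v, A(A v), ... lie in the span of
  \<open>card S\<close> vectors, so they satisfy a linear relation, whose coefficients form the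
  polynomial.\<close>

lemma ex_annihilating_poly:
  assumes A: "linear A" "A ` V \<subseteq> V" and V: "V \<subseteq> span S" "finite S" and v: "v \<in> V"
  shows "\<exists>p. p \<noteq> 0 \<and> poly_map A p v = 0"
proof (rule ccontr)
  assume "\<nexists>p. p \<noteq> 0 \<and> poly_map A p v = 0"
  then have zero: "p = 0" if "poly_map A p v = 0" for p
    using that by blast
  define c where "c i = (A ^^ i) v" for i
  define I where "I = {..card S}"
  \<comment> \<open>Independence speaks about the set of iterates, so repetitions must be excluded
    separately: equal iterates i and j would give the annihilating polynomial X^i - X^j.\<close>
  have inj: "inj_on c I"
  proof (rule inj_onI)
    fix i j assume "c i = c j"
    then have "poly_map A (monom 1 i + monom (-1) j) v = 0"
      by (simp add: poly_map_add poly_map_monom A c_def)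
    then have "coeff (monom (1::real) i + monom (-1) j) i = 0"
      using zero by fastforce
    then show "i = j" by (auto split: if_splits)
  qed
  have "independent (c ` I)"
  proof (rule independent_if_scalars_zero)
    show "finite (c ` I)" by (simp add: I_def)
    fix f x assume "(\<Sum>x\<in>c ` I. f x *\<^sub>R x) = 0" and "x \<in> c ` I"
    then obtain i where i: "i \<in> I" "x = c i" and s: "(\<Sum>i\<in>I. f (c i) *\<^sub>R c i) = 0"
      by (auto simp: sum.reindex[OF inj])
    have "poly_map A (\<Sum>i\<in>I. monom (f (c i)) i) v = 0"
      using s by (simp add: poly_map_sum poly_map_monom A c_def)
    then have "coeff (\<Sum>i\<in>I. monom (f (c i)) i) i = 0"
      using zero by fastforce
    then show "f x = 0"
      using i by (simp add: coeff_sum I_def)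
  qed
  moreover have "c i \<in> V" for i
    using A v by (induction i) (auto simp: c_def)
  ultimately have "card (c ` I) \<le> card S"
    using independent_span_bound[of S "c ` I"] V by blast
  then show False
    by (simp add: card_image[OF inj]) (simp add: I_def)
qed

text \<open>Evaluation of real polynomials at a point of a real algebra is a ring homomorphism. This
  moves a division with remainder over the reals to a complex root.\<close>

lemma
  fixes z :: "'a::{comm_ring_1, real_algebra_1}"
  shows poly_of_real_add:
      "poly (map_poly of_real (p + q)) z = poly (map_poly of_real p) z + poly (map_poly of_real q) z"
    and poly_of_real_mult:
      "poly (map_poly of_real (p * q)) z = poly (map_poly of_real p) z * poly (map_poly of_real q) z"
    and poly_of_real_at_of_real:
      "poly (map_poly of_real p) (of_real x :: 'a) = of_real (poly p x)"
proof -
  show add: "poly (map_poly of_real (p + q)) z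
      = poly (map_poly of_real p) z + poly (map_poly of_real q) z" for p q
    by (induction p q rule: poly_induct2) (simp_all add: map_poly_pCons algebra_simps)
  have "poly (map_poly of_real (smult a q)) z = of_real a * poly (map_poly of_real q) z" for a q
    by (induction q) (simp_all add: map_poly_pCons algebra_simps)
  then show "poly (map_poly of_real (p * q)) z
      = poly (map_poly of_real p) z * poly (map_poly of_real q) z"
    by (induction p) (simp_all add: map_poly_pCons add algebra_simps)
  show "poly (map_poly of_real p) (of_real x :: 'a) = of_real (poly p x)"
    by (induction p) (simp_all add: map_poly_pCons)
qed

text \<open>Positivity is left to the single lemmas: the form on face functions is definite only on
  functions supported on faces, and does not see values on sets outside the complex.\<close>

locale symmetric_form =
  fixes ip :: "'v::real_vector \<Rightarrow> 'v \<Rightarrow> real"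
  assumes linear_left: "linear (\<lambda>u. ip u v)"
    and commute: "ip u v = ip v u"
begin

lemma linear_right: "linear (ip u)"
proof -
  have "ip u = (\<lambda>v. ip v u)" using commute by blast
  then show ?thesis using linear_left by simp
qed

lemmas bilinear_simps =
  linear_add[OF linear_left] linear_diff[OF linear_left] linear_scale[OF linear_left]
  linear_0[OF linear_left] linear_sum[OF linear_left]
  linear_add[OF linear_right] linear_diff[OF linear_right] linear_scale[OF linear_right]
  linear_0[OF linear_right] linear_sum[OF linear_right]

text \<open>Pairing a vanishing combination with \<open>c i\<close> isolates its coefficient.
  Indexed families are used because for the products in the join injectivity of the indexing is
  itself a consequence of orthogonality.\<close>

lemma orthogonal_independent:
  assumes I: "finite I"
    and nz: "\<And>i. i \<in> I \<Longrightarrow> ip (c i) (c i) \<noteq> 0"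
    and orth: "\<And>i j. i \<in> I \<Longrightarrow> j \<in> I \<Longrightarrow> i \<noteq> j \<Longrightarrow> ip (c i) (c j) = 0"
  shows "inj_on c I" and "independent (c ` I)"
proof -
  show inj: "inj_on c I"
    by (rule inj_onI) (metis nz orth)
  show "independent (c ` I)"
  proof (rule independent_if_scalars_zero)
    show "finite (c ` I)" using I by simp
    fix f x assume "(\<Sum>x\<in>c ` I. f x *\<^sub>R x) = 0" and "x \<in> c ` I"
    then obtain i where i: "i \<in> I" "x = c i" and s: "(\<Sum>i\<in>I. f (c i) *\<^sub>R c i) = 0"
      by (auto simp: sum.reindex[OF inj])
    have "0 = ip (\<Sum>j\<in>I. f (c j) *\<^sub>R c j) (c i)"
      by (simp add: s bilinear_simps)
    also have "\<dots> = (\<Sum>j\<in>I. f (c j) * ip (c j) (c i))"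
      by (simp add: bilinear_simps)
    also have "\<dots> = (\<Sum>j\<in>I. if j = i then f (c i) * ip (c i) (c i) else 0)"
      by (rule sum.cong) (auto simp: orth i)
    finally show "f x = 0"
      using nz i I by simp
  qed
qed

text \<open>
  A root of a polynomial \<open>p\<close> of least degree with \<open>p(A) v = 0\<close> yields the eigenvector. The root is
  real, as \<open>(A - a)\<^sup>2 + b\<^sup>2\<close> is positive definite on \<open>V\<close> for \<open>b \<noteq> 0\<close>.
\<close>

lemma ex_eigenvector:
  assumes A: "linear A" "A ` V \<subseteq> V"
    and V: "subspace V" "V \<subseteq> span S" "finite S"
    and pos: "\<And>u. u \<in> V \<Longrightarrow> u \<noteq> 0 \<Longrightarrow> 0 < ip u u"
    and selfadj: "\<And>u v. u \<in> V \<Longrightarrow> v \<in> V \<Longrightarrow> ip (A u) v = ip u (A v)"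
    and v: "v \<in> V" "v \<noteq> 0"
  shows "\<exists>u\<in>V. u \<noteq> 0 \<and> (\<exists>a. A u = a *\<^sub>R u)"
proof -
  define ann where "ann p \<longleftrightarrow> p \<noteq> 0 \<and> poly_map A p v = 0" for p
  obtain p where p: "ann p" and min: "\<And>q. ann q \<Longrightarrow> degree p \<le> degree q"
    using ex_annihilating_poly[OF A V(2,3) v(1)] ex_has_least_nat[of ann _ degree]
    unfolding ann_def by metis
  have "degree p \<noteq> 0"
  proof
    assume "degree p = 0"
    then obtain a where "p = [:a:]" by (metis degree_eq_zeroE)
    then show False using p v A by (simp add: ann_def linear_0)
  qed
  \<comment> \<open>By minimality of the degree, a proper divisor of \<open>p\<close> does not
    annihilate \<open>v\<close>. Its value at \<open>v\<close> is a nonzero vector that the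
    complementary factor kills.\<close>
  have quot: "poly_map A q v \<in> V - {0}" if "p = d * q" "degree d > 0" for d q
  proof -
    have "d \<noteq> 0" "q \<noteq> 0" using p that by (auto simp: ann_def)
    then have "degree q < degree p"
      using that by (simp add: degree_mult_eq)
    then have "\<not> ann q" using min by fastforce
    then show ?thesis
      using \<open>q \<noteq> 0\<close> poly_map_closed[OF A(1) V(1) A(2) v(1)] by (auto simp: ann_def)
  qed
  have "degree (map_poly complex_of_real p) \<noteq> 0"
    using \<open>degree p \<noteq> 0\<close> p by (subst degree_map_poly) auto
  then obtain z where z: "poly (map_poly complex_of_real p) z = 0"
    using fundamental_theorem_of_algebra constant_degree by metis
  show ?thesis
  proof (cases "Im z = 0")
    case True
    then have "z = complex_of_real (Re z)" by (simp add: complex_eq_iff)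
    then have "complex_of_real (poly p (Re z)) = 0"
      using z by (metis poly_of_real_at_of_real)
    then have "[:- Re z, 1:] dvd p"
      by (simp add: poly_eq_0_iff_dvd)
    then obtain q where q: "p = [:- Re z, 1:] * q" by (auto simp: dvd_def)
    define u where "u = poly_map A q v"
    have "poly_map A [:- Re z, 1:] u = 0"
      using p by (simp add: ann_def q u_def flip: poly_map_mult[OF A(1)])
    then have "A u = Re z *\<^sub>R u" using A by (simp add: linear_0)
    moreover have "u \<in> V - {0}"
      unfolding u_def by (rule quot[OF q]) simp
    ultimately show ?thesis by blast
  next
    case False
    define a b where "a = Re z" and "b = Im z"
    \<comment> \<open>The real quadratic with roots z and its conjugate. A remainder of degree below
      2 that vanishes at the nonreal \<open>z\<close> is zero, so \<open>d\<close> divides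
      \<open>p\<close>.\<close>
    define d where "d = [:a\<^sup>2 + b\<^sup>2, - 2 * a, 1:]"
    define r where "r = p mod d"
    have dz: "poly (map_poly complex_of_real d) z = 0"
      by (simp add: d_def a_def b_def complex_eq_iff power2_eq_square map_poly_pCons algebra_simps)
    have "p = d * (p div d) + r"
      by (simp add: r_def)
    then have "poly (map_poly complex_of_real p) z = poly (map_poly of_real d) z
        * poly (map_poly of_real (p div d)) z + poly (map_poly of_real r) z"
      by (metis poly_of_real_add poly_of_real_mult)
    then have rz: "poly (map_poly complex_of_real r) z = 0"
      using z dz by simp
    have "degree r < 2"
      using degree_mod_less'[of d p] by (cases "r = 0") (auto simp: d_def r_def)
    then obtain c0 c1 where r: "r = [:c0, c1:]"
      by (metis One_nat_def degree_eq_zeroE degree_pCons_eq_if less_2_cases_iff nat.inject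
          pCons_cases pCons_0_0)
    have "c1 * b = 0" "c0 + c1 * a = 0"
      using rz by (simp_all add: r complex_eq_iff a_def b_def map_poly_pCons algebra_simps)
    then have "r = 0"
      using False by (simp add: r b_def)
    then have q: "p = d * (p div d)"
      unfolding r_def by (metis add.right_neutral mult_div_mod_eq)
    define u where "u = poly_map A (p div d) v"
    have u: "u \<in> V - {0}"
      unfolding u_def by (rule quot[OF q]) (simp add: d_def)
    then have Au: "A u \<in> V" "A u - a *\<^sub>R u \<in> V"
      using A V by (auto intro!: subspace_diff subspace_scale)
    have "poly_map A d u = 0"
      using p q by (metis A(1) ann_def poly_map_mult u_def)
    then have eq: "(a\<^sup>2 + b\<^sup>2) *\<^sub>R u - (2 * a) *\<^sub>R A u + A (A u) = 0"
      using A by (simp add: d_def linear_0 linear_add linear_scale linear_diff linear_neg add_diff_eq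
          diff_add_eq)
    \<comment> \<open>The left side is the square of A u - a u plus b^2 times the square of u, with
      squares in the sense of \<open>ip\<close>.\<close>
    then have "ip ((a\<^sup>2 + b\<^sup>2) *\<^sub>R u - (2 * a) *\<^sub>R A u + A (A u)) u = 0"
      by (simp add: bilinear_simps)
    then have "(a\<^sup>2 + b\<^sup>2) * ip u u - 2 * a * ip (A u) u + ip (A u) (A u) = 0"
      using selfadj[of "A u" u] u Au by (simp add: bilinear_simps)
    moreover have "0 \<le> ip (A u - a *\<^sub>R u) (A u - a *\<^sub>R u)"
      using pos[OF Au(2)] by (cases "A u - a *\<^sub>R u = 0") (auto simp: bilinear_simps)
    ultimately have "b\<^sup>2 * ip u u \<le> 0"
      by (simp add: bilinear_simps commute[of u "A u"] power2_eq_square algebra_simps)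
    moreover have "0 < ip u u" using pos u by auto
    ultimately show ?thesis
      using False by (simp add: b_def mult_le_0_iff)
  qed
qed

text \<open>Since \<open>B\<close> commutes with \<open>A\<close>, it preserves every eigenspace of
  \<open>A\<close>, and an eigenvector of \<open>B\<close> is sought inside one of them.\<close>

lemma ex_common_eigenvector:
  assumes A: "linear A" "A ` V \<subseteq> V" and B: "linear B" "B ` V \<subseteq> V"
    and V: "subspace V" "V \<subseteq> span S" "finite S"
    and pos: "\<And>u. u \<in> V \<Longrightarrow> u \<noteq> 0 \<Longrightarrow> 0 < ip u u"
    and sA: "\<And>u v. u \<in> V \<Longrightarrow> v \<in> V \<Longrightarrow> ip (A u) v = ip u (A v)"
    and sB: "\<And>u v. u \<in> V \<Longrightarrow> v \<in> V \<Longrightarrow> ip (B u) v = ip u (B v)"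
    and AB: "\<And>u. u \<in> V \<Longrightarrow> A (B u) = B (A u)"
    and v: "v \<in> V" "v \<noteq> 0"
  shows "\<exists>u\<in>V. u \<noteq> 0 \<and> (\<exists>a. A u = a *\<^sub>R u) \<and> (\<exists>b. B u = b *\<^sub>R u)"
proof -
  obtain u a where u: "u \<in> V" "u \<noteq> 0" "A u = a *\<^sub>R u"
    using ex_eigenvector[OF A V pos sA v] by blast
  define W where "W = {x \<in> V. A x = a *\<^sub>R x}"
  have "subspace W"
    using V(1) A(1) unfolding W_def subspace_def
    by (auto simp: linear_0 linear_add linear_scale scaleR_add_right)
  moreover have "B ` W \<subseteq> W"
    using B AB by (auto simp: W_def linear_scale)
  moreover have "W \<subseteq> span S" "W \<subseteq> V" "u \<in> W"
    using V u by (auto simp: W_def)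
  ultimately have "\<exists>x\<in>W. x \<noteq> 0 \<and> (\<exists>b. B x = b *\<^sub>R x)"
    using ex_eigenvector[of B W S u] B(1) V(3) pos sB u(2) by (simp add: subset_eq)
  then show ?thesis by (auto simp: W_def)
qed

text \<open>An orthogonal set of common eigenvectors of maximal cardinality must span
  \<open>V\<close>: otherwise its orthogonal complement is nonzero and invariant, and contains one
  more common eigenvector.\<close>

lemma ex_common_eigenbasis:
  assumes A: "linear A" "A ` V \<subseteq> V" and B: "linear B" "B ` V \<subseteq> V"
    and V: "subspace V" "V \<subseteq> span S" "finite S"
    and pos: "\<And>u. u \<in> V \<Longrightarrow> u \<noteq> 0 \<Longrightarrow> 0 < ip u u"
    and sA: "\<And>u v. u \<in> V \<Longrightarrow> v \<in> V \<Longrightarrow> ip (A u) v = ip u (A v)"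
    and sB: "\<And>u v. u \<in> V \<Longrightarrow> v \<in> V \<Longrightarrow> ip (B u) v = ip u (B v)"
    and AB: "\<And>u. u \<in> V \<Longrightarrow> A (B u) = B (A u)"
  obtains E a b where "finite E" "E \<subseteq> V" "0 \<notin> E" "span E = V"
    "\<And>u v. u \<in> E \<Longrightarrow> v \<in> E \<Longrightarrow> u \<noteq> v \<Longrightarrow> ip u v = 0"
    "\<And>u. u \<in> E \<Longrightarrow> A u = a u *\<^sub>R u" "\<And>u. u \<in> E \<Longrightarrow> B u = b u *\<^sub>R u"
proof -
  define good where "good E \<longleftrightarrow> finite E \<and> E \<subseteq> V \<and> 0 \<notin> E \<and> (\<forall>u\<in>E. \<forall>v\<in>E. u \<noteq> v \<longrightarrow> ip u v = 0)
    \<and> (\<forall>u\<in>E. (\<exists>a. A u = a *\<^sub>R u) \<and> (\<exists>b. B u = b *\<^sub>R u))" for E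
  have bound: "card E \<le> card S" if "good E" for E
  proof -
    have "independent (id ` E)"
      by (rule orthogonal_independent(2)) (use that pos in \<open>fastforce simp: good_def\<close>)+
    then show ?thesis
      using independent_span_bound[of S E] V that by (auto simp: good_def)
  qed
  have "good {}" by (simp add: good_def)
  moreover have "\<forall>E. good E \<longrightarrow> card E < Suc (card S)"
    using bound by (simp add: less_Suc_eq_le)
  ultimately have "\<exists>E. good E \<and> (\<forall>E'. good E' \<longrightarrow> card E' \<le> card E)"
    by (rule ex_has_greatest_nat)
  then obtain E where E: "good E" and max: "\<And>E'. good E' \<Longrightarrow> card E' \<le> card E"
    by blast
  have "span E = V"
  proof (rule ccontr)
    have sub: "span E \<subseteq> V"
      using E V(1) by (simp add: good_def span_minimal)
    assume "span E \<noteq> V"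
    then obtain x where x: "x \<in> V" "x \<notin> span E" using sub by blast
    define W where "W = {u \<in> V. \<forall>e\<in>E. ip u e = 0}"
    \<comment> \<open>\<open>x\<close> minus its orthogonal projection to the span of
      \<open>E\<close>; the vectors of \<open>E\<close> are not normalised, hence the
      division.\<close>
    define y where "y = x - (\<Sum>e\<in>E. (ip x e / ip e e) *\<^sub>R e)"
    have proj: "(\<Sum>e\<in>E. (ip x e / ip e e) *\<^sub>R e) \<in> span E"
      by (intro span_sum span_scale span_base)
    then have "y \<noteq> 0" using x by (auto simp: y_def)
    have "y \<in> W"
      unfolding W_def
    proof (safe)
      show "y \<in> V" using x proj sub V(1) by (auto simp: y_def intro: subspace_diff)
      fix e assume e: "e \<in> E"
      have "ip y e = ip x e - (\<Sum>e'\<in>E. ip x e' / ip e' e' * ip e' e)"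
        by (simp add: y_def bilinear_simps)
      also have "(\<Sum>e'\<in>E. ip x e' / ip e' e' * ip e' e) = (\<Sum>e'\<in>E. if e' = e then ip x e else 0)"
      proof (rule sum.cong)
        fix e' assume e': "e' \<in> E"
        have "0 < ip e e" using e E pos[of e] unfolding good_def by auto
        then show "ip x e' / ip e' e' * ip e' e = (if e' = e then ip x e else 0)"
          using e e' E by (auto simp: good_def)
      qed simp
      also have "\<dots> = ip x e" using e E by (simp add: good_def)
      finally show "ip y e = 0" by simp
    qed
    have "subspace W"
      using V(1) by (auto simp: W_def subspace_def bilinear_simps)
    \<comment> \<open>For e in \<open>E\<close> with T e = t e, self-adjointness gives ip (T u) e =
      t * ip u e = 0.\<close>
    have invariant: "T ` W \<subseteq> W"
      if V: "T ` V \<subseteq> V" and adj: "\<And>u v. u \<in> V \<Longrightarrow> v \<in> V \<Longrightarrow> ip (T u) v = ip u (T v)"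
        and eig: "\<forall>e\<in>E. \<exists>t. T e = t *\<^sub>R e" for T
    proof safe
      fix u assume u: "u \<in> W"
      have "ip (T u) e = 0" if "e \<in> E" for e
      proof -
        obtain t where t: "T e = t *\<^sub>R e" using eig \<open>e \<in> E\<close> by blast
        have "u \<in> V" "e \<in> V" "ip u e = 0" using u E \<open>e \<in> E\<close> by (auto simp: W_def good_def)
        then show ?thesis by (simp add: adj t bilinear_simps)
      qed
      then show "T u \<in> W" using u V by (auto simp: W_def)
    qed
    have "W \<subseteq> V" by (auto simp: W_def)
    have eigA: "\<forall>e\<in>E. \<exists>t. A e = t *\<^sub>R e" and eigB: "\<forall>e\<in>E. \<exists>t. B e = t *\<^sub>R e"
      using E by (auto simp: good_def)
    have "\<exists>u\<in>W. u \<noteq> 0 \<and> (\<exists>a. A u = a *\<^sub>R u) \<and> (\<exists>b. B u = b *\<^sub>R u)"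
    proof (rule ex_common_eigenvector[OF A(1) _ B(1) _ \<open>subspace W\<close> _ V(3)])
      show "A ` W \<subseteq> W" by (rule invariant[OF A(2) sA eigA])
      show "B ` W \<subseteq> W" by (rule invariant[OF B(2) sB eigB])
      show "W \<subseteq> span S" using \<open>W \<subseteq> V\<close> V(2) by blast
      show "y \<in> W" "y \<noteq> 0" by fact+
    qed (use \<open>W \<subseteq> V\<close> in \<open>simp_all add: subset_eq pos sA sB AB\<close>)
    then obtain u where u: "u \<in> W" "u \<noteq> 0" "\<exists>a. A u = a *\<^sub>R u" "\<exists>b. B u = b *\<^sub>R u"
      by blast
    have "0 < ip u u" using u pos by (auto simp: W_def)
    then have "u \<notin> E" using u by (auto simp: W_def)
    moreover have "good (insert u E)"
      using u E by (auto simp: good_def W_def commute)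
    ultimately show False
      using max[of "insert u E"] E by (simp add: good_def)
  qed
  moreover obtain a b where "\<forall>u\<in>E. A u = a u *\<^sub>R u \<and> B u = b u *\<^sub>R u"
    using E unfolding good_def by metis
  ultimately show thesis
    using that[of E a b] E by (auto simp: good_def)
qed

text \<open>The form need not be related to \<open>A\<close>; it only certifies that the
  eigenvectors \<open>c i\<close> are independent. The form may therefore be chosen for convenience,
  which is exploited for the join.\<close>

lemma eigenvalue_mset_orthogonal:
  assumes I: "finite I"
    and nz: "\<And>i. i \<in> I \<Longrightarrow> ip (c i) (c i) \<noteq> 0"
    and orth: "\<And>i j. i \<in> I \<Longrightarrow> j \<in> I \<Longrightarrow> i \<noteq> j \<Longrightarrow> ip (c i) (c j) = 0"
    and V: "span (c ` I) = V"
    and A: "linear A" "\<And>i. i \<in> I \<Longrightarrow> A (c i) = e i *\<^sub>R c i"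
  shows "eigenvalue_mset V A = image_mset e (mset_set I)"
proof -
  have inj: "inj_on c I" and ind: "independent (c ` I)"
    using orthogonal_independent[of I c] I nz orth by blast+
  have eig: "eigenspace_on V A l = span (c ` {i \<in> I. e i = l})" (is "?L = ?R") for l
  proof
    show "?R \<subseteq> ?L"
    proof (rule span_minimal)
      show "c ` {i \<in> I. e i = l} \<subseteq> ?L"
        using V A by (auto simp: eigenspace_on_def intro: span_base)
      show "subspace ?L"
        using A(1) unfolding eigenspace_on_def V[symmetric] subspace_def
        by (auto simp: linear_0 linear_add linear_scale scaleR_add_right span_zero span_add span_scale)
    qed
    show "?L \<subseteq> ?R"
    proof
      fix f assume f: "f \<in> ?L"
      then have "f \<in> span (c ` I)" using V by (simp add: eigenspace_on_def)
      then obtain r where "f = (\<Sum>x\<in>c ` I. r x *\<^sub>R x)"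
        using span_finite[of "c ` I"] I by auto
      then have r: "f = (\<Sum>i\<in>I. r (c i) *\<^sub>R c i)"
        by (simp add: sum.reindex[OF inj])
      have "r (c i) = 0" if i: "i \<in> I" "e i \<noteq> l" for i
      proof -
        \<comment> \<open>Expanding both sides in the basis leaves r (c i) * (e i - l) * ip (c i) (c
          i) = 0, so only basis vectors with eigenvalue \<open>l\<close> occur in
          \<open>f\<close>.\<close>
        have "ip (A f) (c i) = l * ip f (c i)"
          using f by (simp add: eigenspace_on_def bilinear_simps)
        also have "A f = (\<Sum>i\<in>I. (r (c i) * e i) *\<^sub>R c i)"
          by (simp add: r linear_sum[OF A(1)] linear_scale[OF A(1)] A(2))
        finally have "(\<Sum>j\<in>I. r (c j) * (e j - l) * ip (c j) (c i)) = 0"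
          by (simp add: r bilinear_simps sum_distrib_left algebra_simps sum_subtractf)
        moreover have "(\<Sum>j\<in>I. r (c j) * (e j - l) * ip (c j) (c i))
            = (\<Sum>j\<in>I. if j = i then r (c i) * (e i - l) * ip (c i) (c i) else 0)"
          by (rule sum.cong) (auto simp: orth i)
        ultimately show ?thesis
          using I i nz by simp
      qed
      then have "f = (\<Sum>i\<in>{i \<in> I. e i = l}. r (c i) *\<^sub>R c i)"
        unfolding r using I by (intro sum.mono_neutral_right) auto
      also have "\<dots> \<in> ?R"
        by (intro span_sum span_scale span_base) auto
      finally show "f \<in> ?R" .
    qed
  qed
  have dim: "dim (eigenspace_on V A l) = card {i \<in> I. e i = l}" for l
  proof -
    have "independent (c ` {i \<in> I. e i = l})"
      by (rule independent_mono[OF ind]) auto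
    then have "dim (eigenspace_on V A l) = card (c ` {i \<in> I. e i = l})"
      unfolding eig by (rule dim_span_eq_card_independent)
    then show ?thesis
      using card_image[OF inj_on_subset[OF inj, of "{i \<in> I. e i = l}"]] by auto
  qed
  have "(\<exists>f\<in>eigenspace_on V A l. f \<noteq> 0) \<longleftrightarrow> l \<in> e ` I" for l
  proof
    assume "\<exists>f\<in>eigenspace_on V A l. f \<noteq> 0"
    moreover have "eigenspace_on V A l = {0}" if "l \<notin> e ` I"
    proof -
      have "{i \<in> I. e i = l} = {}" using that by blast
      then show ?thesis unfolding eig by (simp only: image_empty span_empty)
    qed
    ultimately show "l \<in> e ` I" by blast
  next
    assume "l \<in> e ` I"
    then obtain i where i: "i \<in> I" "e i = l" by blast
    then have "c i \<noteq> 0" using nz by (force simp: bilinear_simps)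
    moreover have "c i \<in> eigenspace_on V A l"
      unfolding eig using i by (intro span_base) auto
    ultimately show "\<exists>f\<in>eigenspace_on V A l. f \<noteq> 0" by blast
  qed
  then have set: "{l. \<exists>f\<in>eigenspace_on V A l. f \<noteq> 0} = e ` I" by blast
  show ?thesis
  proof (rule multiset_eqI)
    fix l
    have "count (eigenvalue_mset V A) l
        = (\<Sum>x\<in>e ` I. if x = l then card {i \<in> I. e i = l} else 0)"
      unfolding eigenvalue_mset_def set dim by (simp add: count_sum) (rule sum.cong, auto)
    also have "\<dots> = card {i \<in> I. e i = l}"
      using I by (auto simp: image_iff)
    also have "\<dots> = count (image_mset e (mset_set I)) l"
      using I by (simp add: count_image_mset_eq_card_vimage)
    finally show "count (eigenvalue_mset V A) l = count (image_mset e (mset_set I)) l" .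
  qed
qed

end

text \<open>\<open>S\<close> restricts to isomorphisms between the eigenspaces. Injectivity is
  required only on \<open>V\<close>, and \<open>A\<close> is described only on the image of
  \<open>V\<close>: passing to alternating functions forgets values off the complex, and the
  Laplacians are to be evaluated only on cochains.\<close>

lemma eigenvalue_mset_image:
  assumes S: "linear S" "inj_on S V" and V: "subspace V"
    and AS: "\<And>u. u \<in> V \<Longrightarrow> A (S u) = S (B u)" and B: "B ` V \<subseteq> V"
  shows "eigenvalue_mset (S ` V) A = eigenvalue_mset V B"
proof -
  have eig: "eigenspace_on (S ` V) A l = S ` eigenspace_on V B l" for l
  proof -
    have "S (B u) = l *\<^sub>R S u \<longleftrightarrow> B u = l *\<^sub>R u" if "u \<in> V" for u
      using that B V inj_onD[OF S(2), of "B u" "l *\<^sub>R u"]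
      by (auto simp: linear_scale[OF S(1)] subspace_scale image_subset_iff)
    then have "S u \<in> eigenspace_on (S ` V) A l \<longleftrightarrow> u \<in> eigenspace_on V B l" if "u \<in> V" for u
      using that by (simp add: eigenspace_on_def AS)
    moreover have "eigenspace_on (S ` V) A l \<subseteq> S ` V" "eigenspace_on V B l \<subseteq> V"
      by (auto simp: eigenspace_on_def)
    ultimately show ?thesis by blast
  qed
  have "dim (S ` eigenspace_on V B l) = dim (eigenspace_on V B l)" for l
  proof -
    have "span (eigenspace_on V B l) \<subseteq> V"
    proof (rule span_minimal)
      show "eigenspace_on V B l \<subseteq> V" by (auto simp: eigenspace_on_def)
    qed (fact V)
    then have inj: "inj_on S (span (eigenspace_on V B l))"
      using S(2) inj_on_subset by blast
    obtain E where E: "E \<subseteq> eigenspace_on V B l" "independent E" "eigenspace_on V B l \<subseteq> span E"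
      "card E = dim (eigenspace_on V B l)"
      using basis_exists by blast
    have sE: "span E = span (eigenspace_on V B l)"
      using E by (meson span_minimal span_mono subset_antisym subspace_span)
    then have "inj_on S (span E)" using inj by simp
    then have ind: "independent (S ` E)"
      using linear_independent_injective_image[OF S(1) E(2)] by blast
    have "inj_on S E"
      using \<open>inj_on S (span E)\<close> span_superset inj_on_subset by blast
    then have "card (S ` E) = dim (eigenspace_on V B l)"
      using E by (simp add: card_image)
    moreover have "S ` eigenspace_on V B l \<subseteq> span (S ` E)"
      unfolding linear_span_image[OF S(1)] using E by blast
    ultimately show ?thesis
      using dim_unique[of "S ` E"] ind E by blast
  qed
  moreover have "S u = 0 \<longleftrightarrow> u = 0" if "u \<in> eigenspace_on V B l" for u l
    using that S V inj_onD[OF S(2), of u 0]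
    by (auto simp: eigenspace_on_def linear_0 subspace_0)
  ultimately show ?thesis
    unfolding eigenvalue_mset_def eig by (intro sum.cong Collect_cong) auto
qed

lemma sum_fun_apply: "(\<Sum>i\<in>I. f i) x = (\<Sum>i\<in>I. f i x :: 'b::comm_monoid_add)"
  by (induction I rule: infinite_finite_induct) simp_all

lemma scaleR_fun_apply [simp]: "(c *\<^sub>R f) x = c *\<^sub>R f x"
  by (simp add: scaleR_fun_def)

subsection \<open>Cochains as functions on faces\<close>

text \<open>
  Vertices are ordered by an injective rank \<open>r\<close>. A cochain is determined by its values on the
  increasingly ordered faces, that is by a function on faces, and the coboundary acquires signs.
\<close>

definition incidence :: "('a \<Rightarrow> nat) \<Rightarrow> 'a set \<Rightarrow> 'a \<Rightarrow> real" where
  "incidence r F v = (-1) ^ card {u \<in> F. r u < r v}"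

definition face_functions :: "'a set set \<Rightarrow> int \<Rightarrow> ('a set \<Rightarrow> real) set" where
  "face_functions K i = {\<phi>. \<forall>F. F \<notin> faces K i \<longrightarrow> \<phi> F = 0}"

text \<open>There is no degree index, as the formula is the same in all degrees; the degree of a
  function is expressed by its support alone.\<close>

definition face_coboundary ::
  "'a set set \<Rightarrow> ('a \<Rightarrow> nat) \<Rightarrow> ('a set \<Rightarrow> real) \<Rightarrow> 'a set \<Rightarrow> real" where
  "face_coboundary K r \<phi> =
     (\<lambda>F. if F \<in> K then \<Sum>v\<in>F. incidence r F v * \<phi> (F - {v}) else 0)"

definition link_vertices :: "'a set set \<Rightarrow> 'a set \<Rightarrow> 'a set" where
  "link_vertices K F = {v. v \<notin> F \<and> insert v F \<in> K}"

text \<open>The boundary operator of the weighted complex. The quotient turns the weight of the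
  smaller face, under which the result is paired, into that of the larger one.\<close>

definition face_boundary ::
  "'a set set \<Rightarrow> ('a set \<Rightarrow> real) \<Rightarrow> ('a \<Rightarrow> nat) \<Rightarrow> ('a set \<Rightarrow> real) \<Rightarrow> 'a set \<Rightarrow> real" where
  "face_boundary K w r \<phi> =
     (\<lambda>F. if F \<in> K then \<Sum>v\<in>link_vertices K F.
        incidence r F v * (w (insert v F) / w F) * \<phi> (insert v F) else 0)"

text \<open>One form for all degrees at once, so that functions of different degrees are
  orthogonal.\<close>

definition face_form ::
  "'a set set \<Rightarrow> ('a set \<Rightarrow> real) \<Rightarrow> ('a set \<Rightarrow> real) \<Rightarrow> ('a set \<Rightarrow> real) \<Rightarrow> real" where
  "face_form K w \<phi> \<psi> = (\<Sum>F\<in>K. w F * \<phi> F * \<psi> F)"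

text \<open>For a distinct list on which \<open>r\<close> is injective this is -1 to the number of
  inversions, the sign of the permutation that sorts the list by rank.\<close>

primrec list_sign :: "('a \<Rightarrow> nat) \<Rightarrow> 'a list \<Rightarrow> real" where
  "list_sign r [] = 1"
| "list_sign r (x # xs) = incidence r (set xs) x * list_sign r xs"

text \<open>The alternating function whose value on the increasing ordering of a face of
  \<open>K\<close> is that of \<open>\<phi>\<close>; it is 0 off the orderings of faces, to match
  the encoding of cochains.\<close>

definition alternating ::
  "'a set set \<Rightarrow> ('a \<Rightarrow> nat) \<Rightarrow> ('a set \<Rightarrow> real) \<Rightarrow> 'a list \<Rightarrow> real" where
  "alternating K r \<phi> =
     (\<lambda>vs. if distinct vs \<and> set vs \<in> K then list_sign r vs * \<phi> (set vs) else 0)"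

section \<open>Signs of vertices in faces and of orderings\<close>

lemma incidence_square [simp]: "incidence r F v * incidence r F v = 1"
  by (simp add: incidence_def flip: power_mult_distrib)

lemma incidence_cases: "incidence r F v = 1 \<or> incidence r F v = -1"
  by (cases "even (card {u \<in> F. r u < r v})") (simp_all add: incidence_def)

text \<open>The comparison of ranks is strict, so a vertex is not counted in its own sign. Hence one
  sign serves both for deleting a vertex and for inserting it.\<close>

lemma incidence_insert_self [simp]: "incidence r (insert v F) v = incidence r F v"
  unfolding incidence_def by (rule arg_cong[where f = "\<lambda>A. (-1) ^ card A"]) auto

lemma incidence_remove_self [simp]: "incidence r (F - {v}) v = incidence r F v"
  unfolding incidence_def by (rule arg_cong[where f = "\<lambda>A. (-1) ^ card A"]) auto

lemma incidence_insert:
  assumes "finite F" "u \<notin> F"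
  shows "incidence r (insert u F) v = (if r u < r v then - incidence r F v else incidence r F v)"
proof -
  have "{x \<in> insert u F. r x < r v} =
      (if r u < r v then insert u {x \<in> F. r x < r v} else {x \<in> F. r x < r v})" by auto
  then show ?thesis using assms by (simp add: incidence_def)
qed

text \<open>Deleting the vertex of lower rank shifts the position of the other by one, while
  deleting the one of higher rank shifts nothing. This single sign is behind both the vanishing of
  the squared coboundary and the effect of transpositions.\<close>

lemma incidence_swap:
  assumes "finite F" "inj_on r F" "u \<in> F" "v \<in> F" "u \<noteq> v"
  shows "incidence r F v * incidence r (F - {v}) u = - (incidence r F u * incidence r (F - {u}) v)"
proof -
  define G where "G = F - {u, v}"
  have G: "F = insert u (insert v G)" "u \<notin> G" "v \<notin> G" "finite G"
    using assms by (auto simp: G_def)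
  have rm: "F - {v} = insert u G" "F - {u} = insert v G"
    using G \<open>u \<noteq> v\<close> by auto
  have F: "F = insert v (insert u G)" using G by blast
  have "r u \<noteq> r v" using assms by (meson inj_onD)
  have "incidence r F v = (if r u < r v then - incidence r G v else incidence r G v)"
    unfolding F using G by (simp add: incidence_insert)
  moreover have "incidence r F u = (if r v < r u then - incidence r G u else incidence r G u)"
    unfolding G(1) using G by (simp add: incidence_insert)
  ultimately show ?thesis
    using \<open>r u \<noteq> r v\<close> unfolding rm by auto
qed

lemma list_sign_square [simp]: "list_sign r vs * list_sign r vs = 1"
proof (induction vs)
  case (Cons v vs)
  then show ?case using incidence_cases[of r "set vs" v] by auto
qed simp

text \<open>Compares the sign of \<open>y\<close> by its position in the list with the sign by its
  rank: they differ by the change of \<open>list_sign\<close> upon deletion. In the induction an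
  entry in front of \<open>y\<close> is passed by \<open>incidence_swap\<close>.\<close>

lemma list_sign_remove:
  assumes "distinct (xs @ y # ys)" "inj_on r (set (xs @ y # ys))"
  shows "(-1) ^ length xs * list_sign r (xs @ ys)
    = incidence r (set (xs @ y # ys)) y * list_sign r (xs @ y # ys)"
  using assms
proof (induction xs)
  case Nil
  then show ?case by (simp flip: mult.assoc)
next
  case (Cons x xs)
  let ?F = "set (xs @ y # ys)"
  have IH: "(-1) ^ length xs * list_sign r (xs @ ys) = incidence r ?F y * list_sign r (xs @ y # ys)"
    using Cons by simp
  have x: "x \<noteq> y" "x \<notin> ?F" "finite ?F" "y \<in> ?F" using Cons.prems(1) by auto
  have rm: "insert x ?F - {x} = ?F" "insert x ?F - {y} = insert x (set (xs @ ys))"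
    using Cons.prems(1) by auto
  have "incidence r (insert x ?F) y * incidence r (set (xs @ ys)) x
      = - (incidence r ?F x * incidence r ?F y)"
    using incidence_swap[of "insert x ?F" r x y] Cons.prems x unfolding rm by simp
  then have "incidence r (insert x ?F) y * incidence r ?F x
      = - (incidence r (set (xs @ ys)) x * incidence r ?F y)" 
    using incidence_cases[of r "set (xs @ ys)" x] incidence_cases[of r ?F x] by auto
  then have "incidence r (insert x ?F) y * (incidence r ?F x * list_sign r (xs @ y # ys))
      = - (incidence r (set (xs @ ys)) x * (incidence r ?F y * list_sign r (xs @ y # ys)))"
    by (simp flip: mult.assoc)
  then show ?case
    unfolding IH[symmetric] by simp
qed

text \<open>When the swap starts at the head, deleting the later of the two exchanged entries leaves
  \<open>x # ys @ zs\<close> and \<open>y # ys @ zs\<close>, which differ only in the head;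
  \<open>incidence_swap\<close> compares the remaining signs. Entries in front of both see the same
  set behind them.\<close>

lemma list_sign_swap:
  assumes "distinct (xs @ x # ys @ y # zs)" "inj_on r (set (xs @ x # ys @ y # zs))"
  shows "list_sign r (xs @ y # ys @ x # zs) = - list_sign r (xs @ x # ys @ y # zs)"
  using assms
proof (induction xs)
  case Nil
  let ?F = "insert x (insert y (set ys \<union> set zs))" and ?s = "list_sign r"
  have d: "distinct ((x # ys) @ y # zs)" "distinct ((y # ys) @ x # zs)"
    "inj_on r (set ((x # ys) @ y # zs))" "inj_on r (set ((y # ys) @ x # zs))"
    and F: "set ((x # ys) @ y # zs) = ?F" "set ((y # ys) @ x # zs) = ?F"
    and xy: "x \<noteq> y" "x \<notin> set ys \<union> set zs" "y \<notin> set ys \<union> set zs"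
    and inj: "inj_on r ?F"
    using Nil by (auto simp: insert_commute)
  have fin: "finite ?F" by simp
  have sets: "?F - {x} = insert y (set (ys @ zs))" "?F - {y} = insert x (set (ys @ zs))"
    using xy by auto
  have "incidence r ?F y * incidence r (set (ys @ zs)) x
      = - (incidence r ?F x * incidence r (set (ys @ zs)) y)"
    using incidence_swap[OF fin inj, of x y] xy unfolding sets by simp
  \<comment> \<open>The part shared by both lists; the exponent is the position of the deleted
    entry, behind the head and \<open>ys\<close>.\<close>
  moreover define t where "t = (-1) ^ Suc (length ys) * ?s (ys @ zs)"
  have "incidence r ?F y * ?s ((x # ys) @ y # zs) = incidence r (set (ys @ zs)) x * t"
    using list_sign_remove[OF d(1,3)] unfolding F t_def by (simp add: mult.left_commute)
  moreover have "incidence r ?F x * ?s ((y # ys) @ x # zs) = incidence r (set (ys @ zs)) y * t"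
    using list_sign_remove[OF d(2,4)] unfolding F t_def by (simp add: mult.left_commute)
  ultimately have "?s ((y # ys) @ x # zs) = - ?s ((x # ys) @ y # zs)"
    using incidence_cases[of r ?F x] incidence_cases[of r ?F y]
      incidence_cases[of r "set (ys @ zs)" x] incidence_cases[of r "set (ys @ zs)" y]
    by (auto simp del: list_sign.simps)
  then show ?case by simp
next
  case (Cons a xs)
  have "set (xs @ y # ys @ x # zs) = set (xs @ x # ys @ y # zs)" by auto
  moreover have "list_sign r (xs @ y # ys @ x # zs) = - list_sign r (xs @ x # ys @ y # zs)"
    using Cons by simp
  ultimately show ?case by (simp only: append_Cons list_sign.simps)
qed

lemma permute_list_transpose:
  assumes "a < length vs" "b < length vs"
  shows "permute_list (Transposition.transpose a b) vs = vs[a := vs ! b, b := vs ! a]"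
  using assms by (intro nth_equalityI) (auto simp: permute_list_def transpose_def nth_list_update)

lemma list_sign_transpose:
  assumes "a < length vs" "b < length vs" "a < b" "distinct vs" "inj_on r (set vs)"
  shows "list_sign r (permute_list (Transposition.transpose a b) vs) = - list_sign r vs"
proof -
  define xs ys zs where "xs = take a vs" and "ys = take (b - Suc a) (drop (Suc a) vs)"
    and "zs = drop (Suc b) vs"
  have "vs = xs @ vs ! a # drop (Suc a) vs"
    using assms by (simp add: xs_def id_take_nth_drop)
  also have "drop (Suc a) vs = ys @ drop (Suc a) vs ! (b - Suc a) # drop (Suc (b - Suc a)) (drop (Suc a) vs)"
    using assms unfolding ys_def by (intro id_take_nth_drop) simp
  also have "drop (Suc (b - Suc a)) (drop (Suc a) vs) = zs"
    using assms by (simp add: zs_def)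
  also have "drop (Suc a) vs ! (b - Suc a) = vs ! b"
    using assms by simp
  finally have vs: "vs = xs @ vs ! a # ys @ vs ! b # zs" .
  have len: "length xs = a" "length xs + Suc (length ys) = b"
    using assms by (auto simp: xs_def ys_def)
  have "permute_list (Transposition.transpose a b) vs = vs[a := vs ! b, b := vs ! a]"
    by (rule permute_list_transpose[OF assms(1,2)])
  also have "\<dots> = xs @ vs ! b # ys @ vs ! a # zs"
    by (subst vs) (simp add: list_update_append flip: len)
  finally have "permute_list (Transposition.transpose a b) vs = xs @ vs ! b # ys @ vs ! a # zs" .
  then show ?thesis
    using list_sign_swap[of xs "vs ! a" ys "vs ! b" zs r] assms vs by metis
qed

lemma list_sign_permute:
  assumes "\<pi> permutes {..<length vs}" "distinct vs" "inj_on r (set vs)"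
  shows "list_sign r (permute_list \<pi> vs) = of_int (sign \<pi>) * list_sign r vs"
proof -
  \<comment> \<open>The list is quantified inside the induction because the hypothesis for
    \<open>p\<close> is applied to the list already transposed.\<close>
  have "\<forall>vs. length vs = n \<and> distinct vs \<and> inj_on r (set vs) \<longrightarrow>
      list_sign r (permute_list \<pi> vs) = of_int (sign \<pi>) * list_sign r vs"
    if "\<pi> permutes {..<n}" for n
    using that finite_lessThan
  proof (induction \<pi> rule: permutes_induct)
    case id
    then show ?case by simp
  next
    case (swap a b p)
    show ?case
    proof safe
      fix vs assume vs: "n = length vs" "distinct vs" "inj_on r (set vs)"
      let ?t = "Transposition.transpose a b"
      have t: "?t permutes {..<length vs}"
        using swap vs by (simp add: permutes_swap_id)
      have ab: "a < length vs" "b < length vs" "a < b \<or> b < a"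
        using swap vs by auto
      then have "list_sign r (permute_list ?t vs) = - list_sign r vs"
        using list_sign_transpose[OF ab(1,2) _ vs(2,3)] list_sign_transpose[OF ab(2,1) _ vs(2,3)]
        by (metis transpose_commute)
      moreover have "list_sign r (permute_list p (permute_list ?t vs))
          = of_int (sign p) * list_sign r (permute_list ?t vs)"
        using swap vs t by simp
      moreover have "permutation ?t" "permutation p"
        using permutes_imp_permutation[OF _ swap.hyps(4)] by (simp_all add: permutation_swap_id)
      ultimately show "list_sign r (permute_list (?t \<circ> p) vs)
          = of_int (sign (?t \<circ> p)) * list_sign r vs"
        using swap.hyps vs by (simp add: permute_list_compose sign_compose sign_swap_id)
    qed
  qed
  then show ?thesis using assms by blast
qed

section \<open>The weighted complex of face functions and its eigenbases\<close>

lemma face_dim_insert: "face_dim (insert v F) = face_dim F + 1" if "finite F" "v \<notin> F"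
  using that by (simp add: face_dim_def)

lemma subspace_face_functions: "subspace (face_functions K i)"
  by (auto simp: subspace_def face_functions_def)

lemma linear_face_coboundary: "linear (face_coboundary K r)"
  by (rule linearI) (auto simp: face_coboundary_def fun_eq_iff sum.distrib algebra_simps sum_distrib_left)

lemma linear_face_boundary: "linear (face_boundary K w r)"
  by (rule linearI)
     (auto simp: face_boundary_def fun_eq_iff sum.distrib distrib_left sum_distrib_left
         add_divide_distrib ac_simps)

lemma linear_alternating: "linear (alternating K r)"
  by (rule linearI) (auto simp: alternating_def fun_eq_iff algebra_simps)

interpretation face_form: symmetric_form "face_form K w"
  by standard
    (auto intro!: linearI simp: face_form_def sum.distrib algebra_simps sum_distrib_left)

text \<open>\<open>a\<close> and \<open>b\<close> give the eigenvalues of the up- and the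
  down-Laplacian. The last clause attributes each nonzero eigenvalue to one of the two, so that c *
  a u + d * b u is an eigenvalue times its own factor.\<close>

definition face_eigenbasis ::
  "'a set set \<Rightarrow> ('a set \<Rightarrow> real) \<Rightarrow> ('a \<Rightarrow> nat) \<Rightarrow> int \<Rightarrow> ('a set \<Rightarrow> real) set \<Rightarrow>
    (('a set \<Rightarrow> real) \<Rightarrow> real) \<Rightarrow> (('a set \<Rightarrow> real) \<Rightarrow> real) \<Rightarrow> bool" where
  "face_eigenbasis K w r i E a b \<longleftrightarrow>
     finite E \<and> E \<subseteq> face_functions K i \<and> span E = face_functions K i \<and>
     (\<forall>u\<in>E. 0 < face_form K w u u) \<and> (\<forall>u\<in>E. \<forall>v\<in>E. u \<noteq> v \<longrightarrow> face_form K w u v = 0) \<and>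
     (\<forall>u\<in>E. face_boundary K w r (face_coboundary K r u) = a u *\<^sub>R u) \<and>
     (\<forall>u\<in>E. face_coboundary K r (face_boundary K w r u) = b u *\<^sub>R u) \<and>
     (\<forall>u\<in>E. a u = 0 \<or> b u = 0)"

locale ranked_complex =
  fixes K :: "'a set set" and w :: "'a set \<Rightarrow> real" and r :: "'a \<Rightarrow> nat"
  assumes complex: "abstract_complex K" and weight: "weight_function K w"
    and inj_rank: "inj_on r (\<Union>K)"
begin

lemma finite_complex: "finite K"
  and finite_face: "F \<in> K \<Longrightarrow> finite F"
  and face_subset: "F \<in> K \<Longrightarrow> G \<subseteq> F \<Longrightarrow> G \<in> K"
  and weight_pos: "F \<in> K \<Longrightarrow> 0 < w F"
  and inj_rank_face: "F \<in> K \<Longrightarrow> inj_on r F"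
  using complex weight inj_rank
  by (auto simp: abstract_complex_def weight_function_def intro: inj_on_subset)

lemma finite_link_vertices: "finite (link_vertices K F)"
proof (rule finite_subset)
  show "link_vertices K F \<subseteq> \<Union>K" by (auto simp: link_vertices_def)
  show "finite (\<Union>K)" using finite_complex finite_face by blast
qed

lemma face_form_pos:
  assumes "\<phi> \<in> face_functions K i" "\<phi> \<noteq> 0"
  shows "0 < face_form K w \<phi> \<phi>"
proof -
  obtain F where F: "\<phi> F \<noteq> 0" using assms(2) by (auto simp: fun_eq_iff)
  then have "F \<in> K" using assms(1) by (auto simp: face_functions_def faces_def)
  then show ?thesis
    unfolding face_form_def
  proof (intro sum_pos2[OF finite_complex])
    have "0 < w F * (\<phi> F)\<^sup>2" using F weight_pos[OF \<open>F \<in> K\<close>] by simp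
    then show "0 < w F * \<phi> F * \<phi> F" by (simp add: power2_eq_square mult.assoc)
    fix G assume "G \<in> K"
    then have "0 \<le> w G * (\<phi> G)\<^sup>2" using weight_pos[of G] by simp
    then show "0 \<le> w G * \<phi> G * \<phi> G" by (simp add: power2_eq_square mult.assoc)
  qed
qed

lemma face_coboundary_closed:
  assumes "\<phi> \<in> face_functions K i"
  shows "face_coboundary K r \<phi> \<in> face_functions K (i + 1)"
proof -
  have "F - {v} \<notin> faces K i" if "F \<in> K" "F \<notin> faces K (i + 1)" "v \<in> F" for F v
    using that finite_face[of F] face_dim_insert[of "F - {v}" v]
    by (auto simp: faces_def insert_absorb)
  then show ?thesis using assms by (auto simp: face_coboundary_def face_functions_def)
qed

lemma face_boundary_closed:
  assumes "\<phi> \<in> face_functions K (i + 1)"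
  shows "face_boundary K w r \<phi> \<in> face_functions K i"
proof -
  have "insert v F \<notin> faces K (i + 1)" if "F \<in> K" "F \<notin> faces K i" "v \<in> link_vertices K F" for F v
    using that finite_face[of F] face_dim_insert[of F v]
    by (auto simp: faces_def link_vertices_def)
  then show ?thesis using assms by (auto simp: face_boundary_def face_functions_def)
qed

text \<open>Both sides are sums over pairs of a face and one of its facets, indexed on the left by
  the larger face and on the right by the smaller one.\<close>

lemma face_form_adjoint:
  "face_form K w (face_coboundary K r \<phi>) \<psi> = face_form K w \<phi> (face_boundary K w r \<psi>)"
proof -
  have "face_form K w (face_coboundary K r \<phi>) \<psi>
      = (\<Sum>F\<in>K. \<Sum>v\<in>F. w F * incidence r F v * \<phi> (F - {v}) * \<psi> F)"
    by (simp add: face_form_def face_coboundary_def sum_distrib_left sum_distrib_right mult.assoc)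
  also have "\<dots> = (\<Sum>(F, v)\<in>Sigma K (\<lambda>F. F). w F * incidence r F v * \<phi> (F - {v}) * \<psi> F)"
    using finite_complex finite_face by (subst sum.Sigma) auto
  also have "\<dots> = (\<Sum>(G, v)\<in>Sigma K (link_vertices K).
      w G * \<phi> G * (incidence r G v * (w (insert v G) / w G) * \<psi> (insert v G)))"
  proof (rule sum.reindex_bij_witness[where i = "\<lambda>(G, v). (insert v G, v)"
        and j = "\<lambda>(F, v). (F - {v}, v)"], goal_cases)
    case (5 a)
    then obtain F v where a: "a = (F, v)" "F \<in> K" "v \<in> F" by auto
    then have "w (F - {v}) > 0" using weight_pos face_subset by auto
    then show ?case using a by (simp add: insert_absorb)
  qed (auto simp: link_vertices_def insert_absorb intro: face_subset)
  also have "\<dots> = (\<Sum>G\<in>K. \<Sum>v\<in>link_vertices K G.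
      w G * \<phi> G * (incidence r G v * (w (insert v G) / w G) * \<psi> (insert v G)))"
    using finite_complex finite_link_vertices by (subst sum.Sigma) auto
  also have "\<dots> = face_form K w \<phi> (face_boundary K w r \<psi>)"
    by (simp add: face_form_def face_boundary_def sum_distrib_left)
  finally show ?thesis .
qed

lemma face_coboundary_twice: "face_coboundary K r (face_coboundary K r \<phi>) = 0"
proof
  fix F
  show "face_coboundary K r (face_coboundary K r \<phi>) F = 0 F"
  proof (cases "F \<in> K")
    case True
    \<comment> \<open>Putting 0 on the diagonal lets both indices run over all of \<open>F\<close>,
      so that the antisymmetry of \<open>g\<close> makes the double sum vanish.\<close>
    define g where "g v u = (if u = v then 0
      else incidence r F v * incidence r (F - {v}) u * \<phi> (F - {v} - {u}))" for v u
    have "face_coboundary K r (face_coboundary K r \<phi>) F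
        = (\<Sum>v\<in>F. incidence r F v * (\<Sum>u\<in>F - {v}. incidence r (F - {v}) u * \<phi> (F - {v} - {u})))"
      using True face_subset[of F] by (simp add: face_coboundary_def)
    also have "\<dots> = (\<Sum>v\<in>F. \<Sum>u\<in>F. g v u)"
    proof (rule sum.cong)
      fix v assume "v \<in> F"
      have "(\<Sum>u\<in>F. g v u) = (\<Sum>u\<in>F - {v}. g v u)"
        using finite_face[OF True] by (intro sum.mono_neutral_right) (auto simp: g_def)
      also have "\<dots> = (\<Sum>u\<in>F - {v}.
          incidence r F v * (incidence r (F - {v}) u * \<phi> (F - {v} - {u})))"
        by (rule sum.cong) (auto simp: g_def)
      finally show "incidence r F v * (\<Sum>u\<in>F - {v}. incidence r (F - {v}) u * \<phi> (F - {v} - {u}))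
          = (\<Sum>u\<in>F. g v u)"
        by (simp add: sum_distrib_left)
    qed simp
    finally have eq: "face_coboundary K r (face_coboundary K r \<phi>) F = (\<Sum>v\<in>F. \<Sum>u\<in>F. g v u)" .
    have anti: "g v u = - g u v" if "u \<in> F" "v \<in> F" for u v
    proof (cases "u = v")
      case False
      have "F - {v} - {u} = F - {u} - {v}" by auto
      then show ?thesis
        using incidence_swap[OF finite_face[OF True] inj_rank_face[OF True] that False]
        unfolding g_def by simp
    qed (simp add: g_def)
    then have "(\<Sum>v\<in>F. \<Sum>u\<in>F. g v u) = (\<Sum>v\<in>F. \<Sum>u\<in>F. - g u v)"
      by (intro sum.cong refl anti)
    also have "\<dots> = - (\<Sum>u\<in>F. \<Sum>v\<in>F. g u v)"
      by (subst sum.swap) (simp add: sum_negf)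
    finally show ?thesis unfolding eq by simp
  qed (simp add: face_coboundary_def)
qed

text \<open>Follows from the squared coboundary by adjointness: the pairing of the function with
  itself is zero. The degree assumption places it where the form is definite.\<close>

lemma face_boundary_twice:
  assumes "\<phi> \<in> face_functions K (i + 2)"
  shows "face_boundary K w r (face_boundary K w r \<phi>) = 0"
proof (rule ccontr)
  let ?b = "face_boundary K w r (face_boundary K w r \<phi>)"
  assume "?b \<noteq> 0"
  moreover have "?b \<in> face_functions K i"
    using assms face_boundary_closed[of \<phi> "i + 1"]
    by (intro face_boundary_closed) (simp add: add.assoc)
  ultimately have "0 < face_form K w ?b ?b" by (rule face_form_pos[rotated])
  also have "face_form K w ?b ?b = 0"
    by (simp add: face_form_adjoint[symmetric] face_coboundary_twice face_form.bilinear_simps)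
  finally show False by simp
qed

lemma face_functions_subset_span:
  "face_functions K i \<subseteq> span ((\<lambda>F G. if G = F then 1 else 0) ` K)"
proof
  fix \<phi> assume \<phi>: "\<phi> \<in> face_functions K i"
  have "\<phi> = (\<Sum>F\<in>K. \<phi> F *\<^sub>R (\<lambda>G. if G = F then 1 else 0))"
  proof
    fix G
    show "\<phi> G = (\<Sum>F\<in>K. \<phi> F *\<^sub>R (\<lambda>G. if G = F then 1 else 0)) G"
      using \<phi> finite_complex
      by (auto simp: sum_fun_apply face_functions_def faces_def if_distrib cong: if_cong)
  qed
  also have "\<dots> \<in> span ((\<lambda>F G. if G = F then 1 else 0) ` K)"
    by (intro span_sum span_scale span_base) auto
  finally show "\<phi> \<in> span ((\<lambda>F G. if G = F then 1 else 0) ` K)" .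
qed

abbreviation "face_lap_up \<phi> \<equiv> face_boundary K w r (face_coboundary K r \<phi>)"
abbreviation "face_lap_down \<phi> \<equiv> face_coboundary K r (face_boundary K w r \<phi>)"

lemma linear_face_laps:
  shows "linear (\<lambda>\<phi>. face_lap_up \<phi>)" and "linear (\<lambda>\<phi>. face_lap_down \<phi>)"
    and "linear (\<lambda>\<phi>. face_lap_up \<phi> + face_lap_down \<phi>)"
proof -
  show u: "linear (\<lambda>\<phi>. face_lap_up \<phi>)" and d: "linear (\<lambda>\<phi>. face_lap_down \<phi>)"
    using linear_compose[OF linear_face_coboundary linear_face_boundary]
      linear_compose[OF linear_face_boundary linear_face_coboundary] by (auto simp: o_def)
  show "linear (\<lambda>\<phi>. face_lap_up \<phi> + face_lap_down \<phi>)"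
    by (rule linear_compose_add[OF u d])
qed

lemma face_laps_closed:
  assumes "\<phi> \<in> face_functions K i"
  shows "face_lap_up \<phi> \<in> face_functions K i" and "face_lap_down \<phi> \<in> face_functions K i"
  using assms face_coboundary_closed[of \<phi> i] face_boundary_closed[of _ i]
    face_boundary_closed[of \<phi> "i - 1"] face_coboundary_closed[of _ "i - 1"] by simp_all

lemma ex_face_eigenbasis: "\<exists>E a b. face_eigenbasis K w r i E a b"
proof -
  obtain E a b where E: "finite E" "E \<subseteq> face_functions K i" "0 \<notin> E" "span E = face_functions K i"
    "\<And>u v. u \<in> E \<Longrightarrow> v \<in> E \<Longrightarrow> u \<noteq> v \<Longrightarrow> face_form K w u v = 0"
    "\<And>u. u \<in> E \<Longrightarrow> face_lap_up u = a u *\<^sub>R u" "\<And>u. u \<in> E \<Longrightarrow> face_lap_down u = b u *\<^sub>R u"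
  proof (rule face_form.ex_common_eigenbasis[OF linear_face_laps(1) _ linear_face_laps(2) _
        subspace_face_functions face_functions_subset_span[of i]])
    show "finite ((\<lambda>F G. if G = F then 1 else 0) ` K)" using finite_complex by simp
    show "face_lap_up ` face_functions K i \<subseteq> face_functions K i"
      "face_lap_down ` face_functions K i \<subseteq> face_functions K i"
      using face_laps_closed by auto
    \<comment> \<open>Both sides are zero: one contains two successive coboundaries, the other two
      successive boundaries.\<close>
    show "face_lap_up (face_lap_down u) = face_lap_down (face_lap_up u)"
      if "u \<in> face_functions K i" for u
    proof -
      have "face_boundary K w r (face_lap_up u) = 0"
        using face_boundary_twice[of _ "i - 1"] face_coboundary_closed[OF that] by (simp add: add.commute)
      then show ?thesis
        by (simp add: face_coboundary_twice linear_0[OF linear_face_coboundary]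
            linear_0[OF linear_face_boundary])
    qed
    show "face_form K w (face_lap_up u) v = face_form K w u (face_lap_up v)"
      "face_form K w (face_lap_down u) v = face_form K w u (face_lap_down v)" for u v
      using face_form_adjoint face_form.commute by metis+
  qed (use face_form_pos in \<open>auto\<close>)
  moreover have "a u = 0 \<or> b u = 0" if "u \<in> E" for u
  proof -
    have "0 = face_lap_up (face_lap_down u)"
      by (simp add: face_coboundary_twice linear_0[OF linear_face_boundary])
    also have "\<dots> = (b u * a u) *\<^sub>R u"
      using E that by (simp add: linear_scale[OF linear_face_coboundary]
          linear_scale[OF linear_face_boundary])
    finally show ?thesis using E(3) that by auto
  qed
  moreover have "0 < face_form K w u u" if "u \<in> E" for u
    using face_form_pos[of u i] E(2,3) that by blast
  ultimately have "face_eigenbasis K w r i E a b" by (simp add: face_eigenbasis_def)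
  then show ?thesis by blast
qed

section \<open>Identification of face functions with cochains\<close>

lemma alternating_cochain:
  assumes "\<phi> \<in> face_functions K i"
  shows "alternating K r \<phi> \<in> cochains K i"
proof -
  have "alternating K r \<phi> (permute_list \<pi> vs) = of_int (sign \<pi>) * alternating K r \<phi> vs"
    if "vs \<in> ordered_faces K i" "\<pi> permutes {..<length vs}" for vs \<pi>
    using that list_sign_permute[of \<pi> vs r] inj_rank_face[of "set vs"]
    by (simp add: alternating_def ordered_faces_def faces_def)
  moreover have "alternating K r \<phi> vs = 0" if "vs \<notin> ordered_faces K i" for vs
    using that assms by (auto simp: alternating_def ordered_faces_def face_functions_def)
  ultimately show ?thesis by (simp add: cochains_def)
qed

lemma orient_face:
  assumes "F \<in> K"
  shows "distinct (orient F)" and "set (orient F) = F"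
proof -
  have "\<exists>vs. distinct vs \<and> set vs = F"
    using finite_distinct_list[OF finite_face[OF assms]] by blast
  from someI_ex[OF this] show "distinct (orient F)" and "set (orient F) = F"
    unfolding orient_def by auto
qed

lemma alternating_orient:
  assumes "F \<in> K"
  shows "alternating K r \<phi> (orient F) = list_sign r (orient F) * \<phi> F"
  using assms orient_face[OF assms] by (simp add: alternating_def)

lemma cochains_eq: "cochains K i = alternating K r ` face_functions K i"
proof
  show "alternating K r ` face_functions K i \<subseteq> cochains K i"
    using alternating_cochain by blast
  show "cochains K i \<subseteq> alternating K r ` face_functions K i"
  proof
    fix f assume f: "f \<in> cochains K i"
    \<comment> \<open>The value of \<open>f\<close> on the increasing ordering: the sign compensates
      for the arbitrary choice made by \<open>orient\<close>.\<close>
    define \<phi> where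
      "\<phi> F = (if F \<in> faces K i then list_sign r (orient F) * f (orient F) else 0)" for F
    have "f vs = alternating K r \<phi> vs" for vs
    proof (cases "vs \<in> ordered_faces K i")
      case True
      then have vs: "distinct vs" "set vs \<in> K" "set vs \<in> faces K i"
        by (auto simp: ordered_faces_def faces_def)
      let ?o = "orient (set vs)"
      note o = orient_face[OF vs(2)]
      \<comment> \<open>Any two orderings of a face differ by a permutation, which changes
        \<open>f\<close> and \<open>list_sign\<close> by the same sign.\<close>
      have "mset vs = mset ?o"
        using vs o set_eq_iff_mset_eq_distinct[of vs ?o] by simp
      then obtain \<pi> where \<pi>: "\<pi> permutes {..<length ?o}" "permute_list \<pi> ?o = vs"
        by (rule mset_eq_permutation)
      have "f vs = of_int (sign \<pi>) * f ?o"
        using f \<pi> o vs unfolding cochains_def ordered_faces_def by fastforce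
      moreover have "list_sign r vs = of_int (sign \<pi>) * list_sign r ?o"
        using list_sign_permute[OF \<pi>(1) o(1), of r] inj_rank_face[OF vs(2)] o \<pi>(2) by simp
      ultimately show ?thesis
        using vs by (simp add: alternating_def \<phi>_def)
    next
      case False
      then have "f vs = 0" using f by (simp add: cochains_def)
      then show ?thesis
        using False by (auto simp: alternating_def \<phi>_def ordered_faces_def)
    qed
    moreover have "\<phi> \<in> face_functions K i" by (simp add: face_functions_def \<phi>_def)
    ultimately show "f \<in> alternating K r ` face_functions K i" by blast
  qed
qed

lemma inj_on_alternating: "inj_on (alternating K r) (face_functions K i)"
proof (rule inj_onI, rule ext)
  fix \<phi> \<psi> F
  assume *: "\<phi> \<in> face_functions K i" "\<psi> \<in> face_functions K i"
    "alternating K r \<phi> = alternating K r \<psi>"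
  show "\<phi> F = \<psi> F"
  proof (cases "F \<in> K")
    case True
    have "list_sign r (orient F) * \<phi> F = list_sign r (orient F) * \<psi> F"
      using *(3) by (simp flip: alternating_orient[OF True])
    moreover have "list_sign r (orient F) \<noteq> 0"
      by (metis list_sign_square mult_zero_left zero_neq_one)
    ultimately show ?thesis by simp
  next
    case False
    then show ?thesis using * by (auto simp: face_functions_def faces_def)
  qed
qed

text \<open>The definition signs a deletion by list position, \<open>face_coboundary\<close> by
  rank; \<open>list_sign_remove\<close> converts one into the other.\<close>

lemma coboundary_alternating:
  assumes "\<phi> \<in> face_functions K i"
  shows "coboundary K i (alternating K r \<phi>) = alternating K r (face_coboundary K r \<phi>)"
proof
  fix vs
  show "coboundary K i (alternating K r \<phi>) vs = alternating K r (face_coboundary K r \<phi>) vs"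
  proof (cases "vs \<in> ordered_faces K (i + 1)")
    case True
    then have vs: "distinct vs" "set vs \<in> K" by (auto simp: ordered_faces_def faces_def)
    have "(-1) ^ j * alternating K r \<phi> (take j vs @ drop (Suc j) vs)
        = list_sign r vs * (incidence r (set vs) (vs ! j) * \<phi> (set vs - {vs ! j}))"
      if j: "j < length vs" for j
    proof -
      let ?xs = "take j vs" and ?ys = "drop (Suc j) vs"
      have e: "vs = ?xs @ vs ! j # ?ys" using j by (rule id_take_nth_drop)
      then have d: "distinct (?xs @ vs ! j # ?ys)" using vs by simp
      then have rm: "distinct (?xs @ ?ys)" by simp
      have s: "set (?xs @ ?ys) = set vs - {vs ! j}"
        by (subst (3) e) (use d in auto)
      have "(-1) ^ j * list_sign r (?xs @ ?ys) = incidence r (set vs) (vs ! j) * list_sign r vs"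
        using list_sign_remove[OF d, of r] inj_rank_face[OF vs(2)] j by (simp flip: e)
      moreover have "alternating K r \<phi> (?xs @ ?ys) = list_sign r (?xs @ ?ys) * \<phi> (set vs - {vs ! j})"
        unfolding alternating_def s using rm face_subset[OF vs(2)] by auto
      ultimately show ?thesis
        by (simp flip: mult.assoc)
    qed
    then have "coboundary K i (alternating K r \<phi>) vs = (\<Sum>j<length vs.
        list_sign r vs * (incidence r (set vs) (vs ! j) * \<phi> (set vs - {vs ! j})))"
      using True by (simp add: coboundary_def)
    also have "\<dots> = (\<Sum>v\<in>set vs. list_sign r vs * (incidence r (set vs) v * \<phi> (set vs - {v})))"
      using sum.reindex_bij_betw[OF bij_betw_nth[OF vs(1) refl refl],
          of "\<lambda>v. list_sign r vs * (incidence r (set vs) v * \<phi> (set vs - {v}))"] by simp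
    also have "\<dots> = alternating K r (face_coboundary K r \<phi>) vs"
      using vs by (simp add: alternating_def face_coboundary_def sum_distrib_left)
    finally show ?thesis .
  next
    case False
    then show ?thesis
      using alternating_cochain[OF face_coboundary_closed[OF assms]]
      by (simp add: coboundary_def cochains_def)
  qed
qed

lemma cochain_inner_alternating:
  assumes "\<phi> \<in> face_functions K i"
  shows "cochain_inner K w i (alternating K r \<phi>) (alternating K r \<psi>) = face_form K w \<phi> \<psi>"
proof -
  have "cochain_inner K w i (alternating K r \<phi>) (alternating K r \<psi>)
      = (\<Sum>F\<in>faces K i. w F * \<phi> F * \<psi> F)"
    unfolding cochain_inner_def
  proof (rule sum.cong)
    fix F assume "F \<in> faces K i"
    then have "F \<in> K" by (simp add: faces_def)
    then show "w F * alternating K r \<phi> (orient F) * alternating K r \<psi> (orient F) = w F * \<phi> F * \<psi> F"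
      using list_sign_square[of r "orient F"] by (simp add: alternating_orient algebra_simps)
  qed simp
  also have "\<dots> = face_form K w \<phi> \<psi>"
    unfolding face_form_def using finite_complex assms
    by (intro sum.mono_neutral_left) (auto simp: faces_def face_functions_def)
  finally show ?thesis .
qed

text \<open>The definite description has \<open>face_form_adjoint\<close> for existence and
  definiteness for uniqueness.\<close>

lemma coboundary_adjoint_alternating:
  assumes \<psi>: "\<psi> \<in> face_functions K (i + 1)"
  shows "coboundary_adjoint K w i (alternating K r \<psi>) = alternating K r (face_boundary K w r \<psi>)"
  unfolding coboundary_adjoint_def
proof (rule the_equality)
  have b: "face_boundary K w r \<psi> \<in> face_functions K i"
    by (rule face_boundary_closed[OF \<psi>])
  have inner: "cochain_inner K w (i + 1) (coboundary K i (alternating K r \<phi>)) (alternating K r \<psi>)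
      = face_form K w \<phi> (face_boundary K w r \<psi>)" if "\<phi> \<in> face_functions K i" for \<phi>
    using that face_coboundary_closed[OF that]
    by (simp add: coboundary_alternating cochain_inner_alternating face_form_adjoint)
  show "alternating K r (face_boundary K w r \<psi>) \<in> cochains K i \<and>
    (\<forall>f\<in>cochains K i. cochain_inner K w (i + 1) (coboundary K i f) (alternating K r \<psi>) =
       cochain_inner K w i f (alternating K r (face_boundary K w r \<psi>)))"
    using alternating_cochain[OF b] inner
    by (simp add: cochains_eq cochain_inner_alternating)
  fix h assume h: "h \<in> cochains K i \<and>
    (\<forall>f\<in>cochains K i. cochain_inner K w (i + 1) (coboundary K i f) (alternating K r \<psi>) =
       cochain_inner K w i f h)"
  then obtain \<eta> where \<eta>: "\<eta> \<in> face_functions K i" "h = alternating K r \<eta>"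
    by (auto simp: cochains_eq)
  \<comment> \<open>The difference of two candidates serves as its own test function.\<close>
  define \<phi> where "\<phi> = \<eta> - face_boundary K w r \<psi>"
  have \<phi>: "\<phi> \<in> face_functions K i"
    using \<eta> b subspace_face_functions by (auto simp: \<phi>_def intro: subspace_diff)
  then have "face_form K w \<phi> (face_boundary K w r \<psi>) = face_form K w \<phi> \<eta>"
    using h inner[OF \<phi>] cochain_inner_alternating[OF \<phi>] \<eta> alternating_cochain[OF \<phi>] by metis
  then have "face_form K w \<phi> \<phi> = 0"
    unfolding \<phi>_def by (simp only: face_form.bilinear_simps)
  then have "\<phi> = 0" using face_form_pos[OF \<phi>] by force
  then show "h = alternating K r (face_boundary K w r \<psi>)"
    by (simp add: \<eta> \<phi>_def)
qed

lemma laps_alternating: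
  assumes "\<phi> \<in> face_functions K i"
  shows "lap_up K w i (alternating K r \<phi>) = alternating K r (face_lap_up \<phi>)"
    and "lap_down K w i (alternating K r \<phi>) = alternating K r (face_lap_down \<phi>)"
    and "laplacian K w i (alternating K r \<phi>) = alternating K r (face_lap_up \<phi> + face_lap_down \<phi>)"
proof -
  show u: "lap_up K w i (alternating K r \<phi>) = alternating K r (face_lap_up \<phi>)"
    using assms face_coboundary_closed[OF assms]
    by (simp add: lap_up_def coboundary_alternating coboundary_adjoint_alternating)
  show d: "lap_down K w i (alternating K r \<phi>) = alternating K r (face_lap_down \<phi>)"
    using assms face_boundary_closed[of \<phi> "i - 1"]
      coboundary_adjoint_alternating[of \<phi> "i - 1"] coboundary_alternating[of _ "i - 1"]
    by (simp add: lap_down_def)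
  show "laplacian K w i (alternating K r \<phi>) = alternating K r (face_lap_up \<phi> + face_lap_down \<phi>)"
    by (simp add: laplacian_def u d linear_add[OF linear_alternating])
qed

lemma eigs_face_functions:
  shows "lap_up_eigs K w i = eigenvalue_mset (face_functions K i) (\<lambda>\<phi>. face_lap_up \<phi>)"
    and "lap_down_eigs K w i = eigenvalue_mset (face_functions K i) (\<lambda>\<phi>. face_lap_down \<phi>)"
    and "lap_eigs K w i = eigenvalue_mset (face_functions K i) (\<lambda>\<phi>. face_lap_up \<phi> + face_lap_down \<phi>)"
  unfolding lap_up_eigs_def lap_down_eigs_def lap_eigs_def cochains_eq
  by ((rule eigenvalue_mset_image[OF linear_alternating inj_on_alternating subspace_face_functions];
      simp add: image_subset_iff laps_alternating face_laps_closed
        subspace_add[OF subspace_face_functions]))+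

end

subsection \<open>The join\<close>

definition tensor :: "('a set \<Rightarrow> real) \<Rightarrow> ('b set \<Rightarrow> real) \<Rightarrow> ('a + 'b) set \<Rightarrow> real" where
  "tensor \<phi> \<psi> = (\<lambda>F. \<phi> (Inl -` F) * \<psi> (Inr -` F))"

text \<open>The Koszul sign for moving an operator of the second factor past the first. As a
  function of the face it needs no degree; the exponent is the dimension plus one.\<close>

definition signed :: "('a set \<Rightarrow> real) \<Rightarrow> 'a set \<Rightarrow> real" where
  "signed \<phi> = (\<lambda>F. (-1) ^ card F * \<phi> F)"

lemma vimage_Plus [simp]: "Inl -` (A <+> B) = A" "Inr -` (A <+> B) = B"
  by auto

lemma Plus_vimage: "(Inl -` F) <+> (Inr -` F) = F"
proof (rule set_eqI)
  show "x \<in> (Inl -` F) <+> (Inr -` F) \<longleftrightarrow> x \<in> F" for x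
    by (cases x) auto
qed

lemma tensor_Plus [simp]: "tensor \<phi> \<psi> (A <+> B) = \<phi> A * \<psi> B"
  by (simp add: tensor_def)

lemma linear_tensor: "linear (\<lambda>\<phi>. tensor \<phi> \<psi>)" "linear (tensor \<phi>)"
  by (auto intro!: linearI simp: tensor_def fun_eq_iff algebra_simps)

lemmas tensor_simps =
  linear_add[OF linear_tensor(1)] linear_neg[OF linear_tensor(1)] linear_scale[OF linear_tensor(1)]
  linear_add[OF linear_tensor(2)] linear_neg[OF linear_tensor(2)] linear_scale[OF linear_tensor(2)]

lemma signed_signed [simp]: "signed (signed \<phi>) = \<phi>"
  by (simp add: signed_def fun_eq_iff flip: mult.assoc power_mult_distrib)

lemma mem_simplicial_join: "F \<in> simplicial_join K1 K2 \<longleftrightarrow> Inl -` F \<in> K1 \<and> Inr -` F \<in> K2"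
proof
  assume "Inl -` F \<in> K1 \<and> Inr -` F \<in> K2"
  then show "F \<in> simplicial_join K1 K2"
    unfolding simplicial_join_def using Plus_vimage[of F] by blast
qed (auto simp: simplicial_join_def)

lemma simplicial_join_image: "simplicial_join K1 K2 = (\<lambda>(A, B). A <+> B) ` (K1 \<times> K2)"
  by (auto simp: simplicial_join_def)

lemma inj_Plus: "inj_on (\<lambda>(A, B). A <+> B) X"
proof (rule inj_on_inverseI)
  show "(\<lambda>F. (Inl -` F, Inr -` F)) (case x of (A, B) \<Rightarrow> A <+> B) = x" for x :: "'a set \<times> 'b set"
    by (cases x) simp
qed

lemma abstract_complex_join:
  assumes "abstract_complex K1" "abstract_complex K2"
  shows "abstract_complex (simplicial_join K1 K2)"
  unfolding abstract_complex_def
proof (intro conjI ballI allI impI)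
  show "finite (simplicial_join K1 K2)"
    using assms by (simp add: simplicial_join_image abstract_complex_def)
  show "{} \<in> simplicial_join K1 K2"
    using assms by (simp add: mem_simplicial_join abstract_complex_def)
  fix F assume F: "F \<in> simplicial_join K1 K2"
  then have "finite ((Inl -` F) <+> (Inr -` F))"
    using assms by (intro finite_Plus) (auto simp: mem_simplicial_join abstract_complex_def)
  then show "finite F" by (simp add: Plus_vimage)
  fix G assume "G \<subseteq> F"
  then have "Inl -` G \<subseteq> Inl -` F" "Inr -` G \<subseteq> Inr -` F" by auto
  then show "G \<in> simplicial_join K1 K2"
    using F assms unfolding mem_simplicial_join abstract_complex_def by blast
qed

lemma face_dim_Plus:
  assumes "finite A" "finite B"
  shows "face_dim (A <+> B) = face_dim A + face_dim B + 1"
  using assms by (simp add: face_dim_def card_Plus)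

text \<open>With \<open>N\<close> above all ranks in the first complex, every vertex of it precedes
  every vertex of the second.\<close>

definition join_rank :: "('a \<Rightarrow> nat) \<Rightarrow> nat \<Rightarrow> ('b \<Rightarrow> nat) \<Rightarrow> 'a + 'b \<Rightarrow> nat" where
  "join_rank r1 N r2 = case_sum r1 (\<lambda>b. N + r2 b)"

text \<open>The weight here is the plain product, without \<open>p\<close> and \<open>q\<close>, so
  that the form factors. It is used only to detect independence, not self-adjointness.\<close>

lemma face_form_tensor:
  assumes "finite K1" "finite K2"
  shows "face_form (simplicial_join K1 K2) (tensor w1 w2) (tensor \<phi> \<psi>) (tensor \<phi>' \<psi>')
    = face_form K1 w1 \<phi> \<phi>' * face_form K2 w2 \<psi> \<psi>'"
proof -
  have "face_form (simplicial_join K1 K2) (tensor w1 w2) (tensor \<phi> \<psi>) (tensor \<phi>' \<psi>')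
      = (\<Sum>(A, B)\<in>K1 \<times> K2. w1 A * w2 B * (\<phi> A * \<psi> B) * (\<phi>' A * \<psi>' B))"
    unfolding face_form_def simplicial_join_image
    by (subst sum.reindex[OF inj_Plus]) (simp add: case_prod_unfold)
  also have "\<dots> = (\<Sum>A\<in>K1. \<Sum>B\<in>K2. (w1 A * \<phi> A * \<phi>' A) * (w2 B * \<psi> B * \<psi>' B))"
    by (subst sum.cartesian_product) (simp add: ac_simps)
  also have "\<dots> = face_form K1 w1 \<phi> \<phi>' * face_form K2 w2 \<psi> \<psi>'"
    by (simp add: face_form_def sum_product)
  finally show ?thesis .
qed

lemma face_form_disjoint_degrees:
  assumes "\<phi> \<in> face_functions K i" "\<psi> \<in> face_functions K j" "i \<noteq> j"
  shows "face_form K w \<phi> \<psi> = 0"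
  unfolding face_form_def
proof (rule sum.neutral, rule ballI)
  fix F assume "F \<in> K"
  have "F \<notin> faces K i \<or> F \<notin> faces K j" using assms(3) by (auto simp: faces_def)
  then show "w F * \<phi> F * \<psi> F = 0" using assms by (auto simp: face_functions_def)
qed

locale ranked_join = K1: ranked_complex K1 w1 r1 + K2: ranked_complex K2 w2 r2
  for K1 :: "'a set set" and w1 r1 and K2 :: "'b set set" and w2 r2 +
  fixes w :: "('a + 'b) set \<Rightarrow> real" and p q :: "int \<Rightarrow> real" and N :: nat
  assumes p_pos: "F1 \<in> K1 \<Longrightarrow> 0 < p (face_dim F1)"
    and q_pos: "F2 \<in> K2 \<Longrightarrow> 0 < q (face_dim F2)"
    and w_join: "F1 \<in> K1 \<Longrightarrow> F2 \<in> K2 \<Longrightarrow>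
      w (F1 <+> F2) = p (face_dim F1) * w1 F1 * q (face_dim F2) * w2 F2"
    and rank_less: "v \<in> \<Union>K1 \<Longrightarrow> r1 v < N"
begin

abbreviation "J \<equiv> simplicial_join K1 K2"
abbreviation "r \<equiv> join_rank r1 N r2"

sublocale J: ranked_complex J w r
proof
  show "abstract_complex J"
    using K1.complex K2.complex by (rule abstract_complex_join)
  show "weight_function J w"
    unfolding weight_function_def
  proof
    fix F assume "F \<in> J"
    then obtain A B where F: "F = A <+> B" "A \<in> K1" "B \<in> K2" by (auto simp: simplicial_join_def)
    then show "0 < w F"
      by (simp add: w_join p_pos q_pos K1.weight_pos K2.weight_pos)
  qed
  show "inj_on r (\<Union>J)"
  proof (rule inj_onI)
    fix x y assume x: "x \<in> \<Union>J" and y: "y \<in> \<Union>J" and eq: "r x = r y"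
    have in1: "v \<in> \<Union>K1" if "Inl v \<in> \<Union>J" for v
      using that by (force simp: simplicial_join_def)
    have in2: "v \<in> \<Union>K2" if "Inr v \<in> \<Union>J" for v
      using that by (force simp: simplicial_join_def)
    show "x = y"
      using in1[of "projl x"] in1[of "projl y"] in2[of "projr x"] in2[of "projr y"] x y eq
        rank_less[of "projl x"] rank_less[of "projl y"]
        inj_onD[OF K1.inj_rank, of "projl x" "projl y"] inj_onD[OF K2.inj_rank, of "projr x" "projr y"]
      by (cases x; cases y) (simp_all add: join_rank_def)
  qed
qed

lemma incidence_Plus_Inl:
  assumes "v \<in> \<Union>K1"
  shows "incidence r (A <+> B) (Inl v) = incidence r1 A v"
proof -
  have "{u \<in> A <+> B. r u < r (Inl v)} = Inl ` {u \<in> A. r1 u < r1 v}"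
    using rank_less[OF assms] by (auto simp: join_rank_def)
  then show ?thesis by (simp add: incidence_def card_image)
qed

lemma incidence_Plus_Inr:
  assumes "A \<in> K1" "B \<in> K2"
  shows "incidence r (A <+> B) (Inr v) = (-1) ^ card A * incidence r2 B v"
proof -
  have "r1 u < N + r2 v" if "u \<in> A" for u
    using that assms(1) rank_less by (intro trans_less_add1) blast
  then have "{u \<in> A <+> B. r u < r (Inr v)} = A <+> {u \<in> B. r2 u < r2 v}"
    by (auto simp: join_rank_def)
  then show ?thesis
    using K1.finite_face[OF assms(1)] K2.finite_face[OF assms(2)]
    by (simp add: incidence_def card_Plus power_add)
qed

text \<open>The operator relates faces whose numbers of vertices differ by one, so it anticommutes
  with the sign. This is the source of the cancellation of mixed terms.\<close>

lemma signed_face_coboundary: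
  "signed (face_coboundary K1 r1 \<phi>) = - face_coboundary K1 r1 (signed \<phi>)"
proof
  fix F
  have "(-1) ^ card F * (incidence r1 F v * \<phi> (F - {v}))
      = - (incidence r1 F v * ((-1) ^ card (F - {v}) * \<phi> (F - {v})))" if "F \<in> K1" "v \<in> F" for v
    using card.remove[OF K1.finite_face[OF that(1)] that(2)] by simp
  then show "signed (face_coboundary K1 r1 \<phi>) F = (- face_coboundary K1 r1 (signed \<phi>)) F"
    by (simp add: signed_def face_coboundary_def sum_distrib_left flip: sum_negf)
qed

lemma signed_face_boundary:
  "signed (face_boundary K1 w1 r1 \<phi>) = - face_boundary K1 w1 r1 (signed \<phi>)"
proof
  fix F
  have "(-1) ^ card F * (incidence r1 F v * (w1 (insert v F) / w1 F) * \<phi> (insert v F))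
      = - (incidence r1 F v * (w1 (insert v F) / w1 F) * ((-1) ^ card (insert v F) * \<phi> (insert v F)))"
    if "F \<in> K1" "v \<in> link_vertices K1 F" for v
    using K1.finite_face[OF that(1)] that(2) by (simp add: link_vertices_def)
  then show "signed (face_boundary K1 w1 r1 \<phi>) F = (- face_boundary K1 w1 r1 (signed \<phi>)) F"
    by (simp add: signed_def face_boundary_def sum_distrib_left flip: sum_negf)
qed

lemma tensor_closed:
  assumes "\<phi> \<in> face_functions K1 i" "\<psi> \<in> face_functions K2 j"
  shows "tensor \<phi> \<psi> \<in> face_functions J (i + j + 1)"
  unfolding face_functions_def
proof (safe)
  fix F assume F: "F \<notin> faces J (i + j + 1)"
  show "tensor \<phi> \<psi> F = 0"
  proof (rule ccontr)
    assume "tensor \<phi> \<psi> F \<noteq> 0"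
    then have "Inl -` F \<in> faces K1 i" "Inr -` F \<in> faces K2 j"
      using assms by (auto simp: tensor_def face_functions_def)
    then have "F \<in> J" "face_dim ((Inl -` F) <+> (Inr -` F)) = i + j + 1"
      using K1.finite_face K2.finite_face
      by (auto simp: faces_def mem_simplicial_join face_dim_Plus)
    then show False using F by (simp add: faces_def Plus_vimage)
  qed
qed

text \<open>A deleted vertex lies in one of the two parts, and one in the second part is preceded by
  all of the first, which produces \<open>signed\<close>. The supports are needed on sets outside
  the join, where the right side must vanish too.\<close>

lemma face_coboundary_tensor:
  assumes \<phi>: "\<phi> \<in> face_functions K1 i" and \<psi>: "\<psi> \<in> face_functions K2 j"
  shows "face_coboundary J r (tensor \<phi> \<psi>)
    = tensor (face_coboundary K1 r1 \<phi>) \<psi> + tensor (signed \<phi>) (face_coboundary K2 r2 \<psi>)"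
proof
  fix F :: "('a + 'b) set"
  define A B where "A = Inl -` F" and "B = Inr -` F"
  have F: "F = A <+> B" by (simp add: A_def B_def Plus_vimage)
  show "face_coboundary J r (tensor \<phi> \<psi>) F
    = (tensor (face_coboundary K1 r1 \<phi>) \<psi> + tensor (signed \<phi>) (face_coboundary K2 r2 \<psi>)) F"
  proof (cases "A \<in> K1 \<and> B \<in> K2")
    case True
    then have AB: "A \<in> K1" "B \<in> K2" by auto
    have rm: "(A <+> B) - {Inl v} = (A - {v}) <+> B" "(A <+> B) - {Inr u} = A <+> (B - {u})" for u v
      by auto
    have inc: "incidence r (A <+> B) (Inl v) = incidence r1 A v" if "v \<in> A" for v
      using incidence_Plus_Inl AB that by blast
    have "face_coboundary J r (tensor \<phi> \<psi>) F
      = (\<Sum>x\<in>A <+> B. incidence r (A <+> B) x * tensor \<phi> \<psi> ((A <+> B) - {x}))"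
      using AB by (simp add: face_coboundary_def mem_simplicial_join F)
    also have "\<dots> = (\<Sum>v\<in>A. incidence r1 A v * (\<phi> (A - {v}) * \<psi> B))
        + (\<Sum>v\<in>B. (-1) ^ card A * incidence r2 B v * (\<phi> A * \<psi> (B - {v})))"
      using K1.finite_face[OF AB(1)] K2.finite_face[OF AB(2)]
      by (simp add: sum.Plus o_def rm inc incidence_Plus_Inr[OF AB])
    also have "\<dots> = (tensor (face_coboundary K1 r1 \<phi>) \<psi>
        + tensor (signed \<phi>) (face_coboundary K2 r2 \<psi>)) F"
      using AB by (simp add: F face_coboundary_def signed_def sum_distrib_left sum_distrib_right ac_simps)
    finally show ?thesis .
  next
    case False
    then show ?thesis
      using \<phi> \<psi> unfolding F
      by (auto simp: face_coboundary_def mem_simplicial_join signed_def face_functions_def faces_def)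
  qed
qed

lemma face_boundary_tensor:
  assumes \<phi>: "\<phi> \<in> face_functions K1 i" and \<psi>: "\<psi> \<in> face_functions K2 j"
  shows "face_boundary J w r (tensor \<phi> \<psi>)
    = (p i / p (i - 1)) *\<^sub>R tensor (face_boundary K1 w1 r1 \<phi>) \<psi>
      + (q j / q (j - 1)) *\<^sub>R tensor (signed \<phi>) (face_boundary K2 w2 r2 \<psi>)"
proof
  fix F :: "('a + 'b) set"
  define A B where "A = Inl -` F" and "B = Inr -` F"
  have F: "F = A <+> B" by (simp add: A_def B_def Plus_vimage)
  show "face_boundary J w r (tensor \<phi> \<psi>) F
    = ((p i / p (i - 1)) *\<^sub>R tensor (face_boundary K1 w1 r1 \<phi>) \<psi>
      + (q j / q (j - 1)) *\<^sub>R tensor (signed \<phi>) (face_boundary K2 w2 r2 \<psi>)) F"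
  proof (cases "A \<in> K1 \<and> B \<in> K2")
    case True
    then have AB: "A \<in> K1" "B \<in> K2" by auto
    note fin = K1.finite_face[OF AB(1)] K2.finite_face[OF AB(2)]
    note pos = p_pos[OF AB(1)] q_pos[OF AB(2)] K1.weight_pos[OF AB(1)] K2.weight_pos[OF AB(2)]
    have ins: "insert (Inl v) (A <+> B) = insert v A <+> B"
      "insert (Inr u) (A <+> B) = A <+> insert u B" for u v
      by auto
    have link: "link_vertices J (A <+> B) = link_vertices K1 A <+> link_vertices K2 B"
    proof (rule set_eqI)
      show "x \<in> link_vertices J (A <+> B) \<longleftrightarrow> x \<in> link_vertices K1 A <+> link_vertices K2 B" for x
        using AB by (cases x) (auto simp: link_vertices_def ins mem_simplicial_join)
    qed
    let ?x = "\<lambda>v. incidence r1 A v * (w1 (insert v A) / w1 A) * \<phi> (insert v A)"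
    let ?y = "\<lambda>v. incidence r2 B v * (w2 (insert v B) / w2 B) * \<psi> (insert v B)"
    \<comment> \<open>Only terms with nonzero \<open>\<phi> (insert v A)\<close> matter. There
      \<open>A\<close> has dimension i - 1, which fixes the quotient of \<open>p\<close>, while the
      \<open>q\<close> and \<open>w2\<close> factors cancel.\<close>
    have x: "incidence r (A <+> B) (Inl v) * (w (insert v A <+> B) / w (A <+> B)) * (\<phi> (insert v A) * \<psi> B)
        = p i / p (i - 1) * (?x v * \<psi> B)" if v: "v \<in> link_vertices K1 A" for v
    proof (cases "\<phi> (insert v A) = 0")
      case False
      then have "face_dim (insert v A) = i"
        using \<phi> by (auto simp: face_functions_def faces_def)
      moreover have "face_dim (insert v A) = face_dim A + 1" and vK: "insert v A \<in> K1"
        using v fin face_dim_insert[of A v] by (auto simp: link_vertices_def)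
      ultimately have "face_dim (insert v A) = i" "face_dim A = i - 1" by auto
      moreover have "incidence r (A <+> B) (Inl v) = incidence r1 A v"
        using incidence_Plus_Inl vK by blast
      ultimately show ?thesis
        using pos by (simp add: w_join[OF vK AB(2)] w_join[OF AB])
    qed simp
    have y: "incidence r (A <+> B) (Inr v) * (w (A <+> insert v B) / w (A <+> B)) * (\<phi> A * \<psi> (insert v B))
        = q j / q (j - 1) * ((-1) ^ card A * \<phi> A * ?y v)" if v: "v \<in> link_vertices K2 B" for v
    proof (cases "\<psi> (insert v B) = 0")
      case False
      then have "face_dim (insert v B) = j"
        using \<psi> by (auto simp: face_functions_def faces_def)
      moreover have "face_dim (insert v B) = face_dim B + 1" and vK: "insert v B \<in> K2"
        using v fin face_dim_insert[of B v] by (auto simp: link_vertices_def)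
      ultimately have "face_dim (insert v B) = j" "face_dim B = j - 1" by auto
      then show ?thesis
        using pos by (simp add: w_join[OF AB(1) vK] w_join[OF AB] incidence_Plus_Inr[OF AB])
    qed simp
    have "face_boundary J w r (tensor \<phi> \<psi>) F
      = (\<Sum>x\<in>link_vertices K1 A <+> link_vertices K2 B. incidence r (A <+> B) x
          * (w (insert x (A <+> B)) / w (A <+> B)) * tensor \<phi> \<psi> (insert x (A <+> B)))"
      using AB by (simp add: face_boundary_def mem_simplicial_join F link)
    also have "\<dots> = (\<Sum>v\<in>link_vertices K1 A. p i / p (i - 1) * (?x v * \<psi> B))
        + (\<Sum>v\<in>link_vertices K2 B. q j / q (j - 1) * ((-1) ^ card A * \<phi> A * ?y v))"
      using K1.finite_link_vertices K2.finite_link_vertices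
      by (simp add: sum.Plus o_def ins x y del: times_divide_eq_left times_divide_eq_right)
    also have "\<dots> = ((p i / p (i - 1)) *\<^sub>R tensor (face_boundary K1 w1 r1 \<phi>) \<psi>
        + (q j / q (j - 1)) *\<^sub>R tensor (signed \<phi>) (face_boundary K2 w2 r2 \<psi>)) F"
      using AB by (simp add: F face_boundary_def signed_def sum_distrib_left sum_distrib_right
          sum_divide_distrib ac_simps)
    finally show ?thesis .
  next
    case False
    then show ?thesis
      using \<phi> \<psi> unfolding F
      by (auto simp: face_boundary_def mem_simplicial_join signed_def face_functions_def faces_def)
  qed
qed

text \<open>The adjoint acts on degree i + 1 in the up-part and on degree i in the down-part, which
  yields the two quotients for \<open>\<phi>\<close>; likewise for \<open>\<psi>\<close>.\<close>

lemma face_lap_tensor: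
  assumes \<phi>: "\<phi> \<in> face_functions K1 i" and \<psi>: "\<psi> \<in> face_functions K2 j"
  shows "J.face_lap_up (tensor \<phi> \<psi>) + J.face_lap_down (tensor \<phi> \<psi>)
    = tensor ((p (i + 1) / p i) *\<^sub>R K1.face_lap_up \<phi> + (p i / p (i - 1)) *\<^sub>R K1.face_lap_down \<phi>) \<psi>
      + tensor \<phi> ((q (j + 1) / q j) *\<^sub>R K2.face_lap_up \<psi> + (q j / q (j - 1)) *\<^sub>R K2.face_lap_down \<psi>)"
proof -
  have s: "signed \<phi> \<in> face_functions K1 i"
    using \<phi> by (simp add: face_functions_def signed_def)
  have d1: "face_coboundary K1 r1 \<phi> \<in> face_functions K1 (i + 1)"
    and d2: "face_coboundary K2 r2 \<psi> \<in> face_functions K2 (j + 1)"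
    using \<phi> \<psi> K1.face_coboundary_closed K2.face_coboundary_closed by auto
  have b1: "face_boundary K1 w1 r1 \<phi> \<in> face_functions K1 (i - 1)"
    and b2: "face_boundary K2 w2 r2 \<psi> \<in> face_functions K2 (j - 1)"
    using \<phi> \<psi> K1.face_boundary_closed[of \<phi> "i - 1"] K2.face_boundary_closed[of \<psi> "j - 1"] by auto
  have up: "J.face_lap_up (tensor \<phi> \<psi>) =
      (p (i + 1) / p i) *\<^sub>R tensor (K1.face_lap_up \<phi>) \<psi>
      - (q j / q (j - 1)) *\<^sub>R tensor (face_coboundary K1 r1 (signed \<phi>)) (face_boundary K2 w2 r2 \<psi>)
      + (p i / p (i - 1)) *\<^sub>R tensor (face_boundary K1 w1 r1 (signed \<phi>)) (face_coboundary K2 r2 \<psi>)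
      + (q (j + 1) / q j) *\<^sub>R tensor \<phi> (K2.face_lap_up \<psi>)"
    by (simp add: face_coboundary_tensor[OF \<phi> \<psi>] linear_add[OF linear_face_boundary]
        face_boundary_tensor[OF d1 \<psi>] face_boundary_tensor[OF s d2] signed_face_coboundary
        tensor_simps)
  \<comment> \<open>The same mixed terms as in \<open>up\<close>, with opposite signs and equal
    quotients: the one for \<open>K2\<close> depends only on j, which the coboundary of
    \<open>K1\<close> leaves alone, and symmetrically.\<close>
  have down: "J.face_lap_down (tensor \<phi> \<psi>) =
      (p i / p (i - 1)) *\<^sub>R (tensor (K1.face_lap_down \<phi>) \<psi>
        - tensor (face_boundary K1 w1 r1 (signed \<phi>)) (face_coboundary K2 r2 \<psi>))
      + (q j / q (j - 1)) *\<^sub>R (tensor (face_coboundary K1 r1 (signed \<phi>)) (face_boundary K2 w2 r2 \<psi>)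
        + tensor \<phi> (K2.face_lap_down \<psi>))"
    by (simp add: face_boundary_tensor[OF \<phi> \<psi>] linear_add[OF linear_face_coboundary]
        linear_scale[OF linear_face_coboundary] face_coboundary_tensor[OF b1 \<psi>]
        face_coboundary_tensor[OF s b2] signed_face_boundary tensor_simps)
  show ?thesis
    unfolding up down by (simp add: tensor_simps scaleR_add_right scaleR_diff_right)
qed

text \<open>The indicator of a face of the join is the product of the indicators of its two parts,
  whose dimensions are at least -1.\<close>

lemma face_functions_join_subset:
  assumes X: "\<And>i1 i2 \<phi> \<psi>. -1 \<le> i1 \<Longrightarrow> -1 \<le> i2 \<Longrightarrow> i1 + i2 + 1 = i \<Longrightarrow>
      \<phi> \<in> face_functions K1 i1 \<Longrightarrow> \<psi> \<in> face_functions K2 i2 \<Longrightarrow> tensor \<phi> \<psi> \<in> span X"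
  shows "face_functions J i \<subseteq> span X"
proof
  fix f assume f: "f \<in> face_functions J i"
  define \<delta>1 :: "'a set \<Rightarrow> 'a set \<Rightarrow> real" where "\<delta>1 A = (\<lambda>G. if G = A then 1 else 0)" for A
  define \<delta>2 :: "'b set \<Rightarrow> 'b set \<Rightarrow> real" where "\<delta>2 B = (\<lambda>G. if G = B then 1 else 0)" for B
  have \<delta>: "tensor (\<delta>1 (Inl -` F)) (\<delta>2 (Inr -` F)) G = (if G = F then 1 else 0)" for F G
    using Plus_vimage[of F] Plus_vimage[of G] by (auto simp: tensor_def \<delta>1_def \<delta>2_def)
  have "f = (\<Sum>F\<in>faces J i. f F *\<^sub>R tensor (\<delta>1 (Inl -` F)) (\<delta>2 (Inr -` F)))"
  proof
    fix G
    have "finite (faces J i)" using J.finite_complex by (simp add: faces_def)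
    then show "f G = (\<Sum>F\<in>faces J i. f F *\<^sub>R tensor (\<delta>1 (Inl -` F)) (\<delta>2 (Inr -` F))) G"
      using f by (auto simp: sum_fun_apply \<delta> face_functions_def if_distrib cong: if_cong)
  qed
  also have "\<dots> \<in> span X"
  proof (intro span_sum span_scale)
    fix F assume "F \<in> faces J i"
    then have F: "Inl -` F \<in> K1" "Inr -` F \<in> K2" "face_dim ((Inl -` F) <+> (Inr -` F)) = i"
      by (auto simp: faces_def mem_simplicial_join Plus_vimage)
    show "tensor (\<delta>1 (Inl -` F)) (\<delta>2 (Inr -` F)) \<in> span X"
    proof (rule X)
      show "face_dim (Inl -` F) + face_dim (Inr -` F) + 1 = i"
        using F K1.finite_face K2.finite_face by (simp add: face_dim_Plus)
    qed (use F in \<open>auto simp: face_functions_def faces_def \<delta>1_def \<delta>2_def face_dim_def\<close>)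
  qed
  finally show "f \<in> span X" .
qed

end

section \<open>From eigenbases to factored eigenvalues\<close>

text \<open>Each \<open>u\<close> survives exactly one of the three filters: since one of
  \<open>a u\<close> and \<open>b u\<close> is zero, their sum is zero only if both are.\<close>

lemma filtered_eigs_union:
  fixes c d :: real
  assumes "\<forall>u\<in>#M. a u = 0 \<or> b u = 0"
  shows "{#c * l. l \<in># filter_mset (\<lambda>x. x \<noteq> 0) (image_mset a M)#}
      + {#d * l. l \<in># filter_mset (\<lambda>x. x \<noteq> 0) (image_mset b M)#}
      + {#l \<in># image_mset (\<lambda>u. a u + b u) M. l = 0#} = {#c * a u + d * b u. u \<in># M#}"
  using assms by (induction M) auto

context ranked_complex
begin

lemma factored_eigs_eigenbasis:
  assumes "face_eigenbasis K w r i E a b"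
  shows "image_mset (\<lambda>(l, P). P * l) (factored_eigs p K w i)
    = {#p (i + 1) / p i * a u + p i / p (i - 1) * b u. u \<in># mset_set E#}"
proof -
  note E = assms[unfolded face_eigenbasis_def]
  have eigs: "eigenvalue_mset (face_functions K i) A = image_mset e (mset_set E)"
    if "linear A" "\<And>u. u \<in> E \<Longrightarrow> A u = e u *\<^sub>R u" for A e
    by (rule face_form.eigenvalue_mset_orthogonal[where K = K and w = w and c = "\<lambda>u. u"])
       (use E that in \<open>force+\<close>)
  have "lap_up_eigs K w i = image_mset a (mset_set E)"
    "lap_down_eigs K w i = image_mset b (mset_set E)"
    "lap_eigs K w i = image_mset (\<lambda>u. a u + b u) (mset_set E)"
    unfolding eigs_face_functions
    by (rule eigs; use E in \<open>simp add: linear_face_laps scaleR_add_left\<close>)+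
  moreover have "\<forall>u\<in>#mset_set E. a u = 0 \<or> b u = 0" using E by simp
  ultimately show ?thesis
    using filtered_eigs_union[of "mset_set E" a b "p (i + 1) / p i" "p i / p (i - 1)"]
    by (simp add: factored_eigs_def multiset.map_comp o_def)
qed

end

lemma image_mset_mset_set: "image_mset e (mset_set I) = (\<Sum>x\<in>I. {#e x#})"
  by (induction I rule: infinite_finite_induct) simp_all

text \<open>The summand sees a pair only through its product, so the pairs may be replaced by an
  eigenbasis that gives the same products.\<close>

lemma sum_mset_image_prod:
  fixes g :: "real \<Rightarrow> real multiset"
  assumes "image_mset (\<lambda>(l, P). P * l) M = image_mset x (mset_set E)"
  shows "(\<Sum>(l, P)\<in>#M. g (P * l)) = (\<Sum>u\<in>E. g (x u))"
proof -
  have "(\<Sum>(l, P)\<in>#M. g (P * l)) = \<Sum>\<^sub># (image_mset g (image_mset (\<lambda>(l, P). P * l) M))"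
    by (simp add: multiset.map_comp o_def case_prod_unfold)
  then show ?thesis by (simp add: assms multiset.map_comp o_def sum_unfold_sum_mset)
qed

lemma face_dim_mem:
  assumes "abstract_complex K" "F \<in> K"
  shows "face_dim F \<in> {-1..complex_dim K}"
  using assms by (simp add: face_dim_def complex_dim_def abstract_complex_def)

lemma ex_rank:
  assumes "abstract_complex K"
  obtains r :: "'a \<Rightarrow> nat" where "inj_on r (\<Union>K)"
proof -
  have "finite (\<Union>K)" using assms by (auto simp: abstract_complex_def)
  then obtain r :: "'a \<Rightarrow> nat" and n where "r ` \<Union>K = {i. i < n} \<and> inj_on r (\<Union>K)"
    using finite_imp_inj_to_nat_seg by metis
  then show thesis using that by blast
qed

context ranked_join
begin

text \<open>Products of basis vectors of all admissible degrees form an eigenbasis of the join; the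
  multiset is read off from it, zeros included.\<close>

lemma lap_eigs_join:
  assumes E1: "\<And>i. face_eigenbasis K1 w1 r1 i (E1 i) (a1 i) (b1 i)"
    and E2: "\<And>i. face_eigenbasis K2 w2 r2 i (E2 i) (a2 i) (b2 i)"
  shows "lap_eigs J w i =
    (\<Sum>(i1, i2)\<in>{(i1, i2). -1 \<le> i1 \<and> -1 \<le> i2 \<and> i1 + i2 + 1 = i}. \<Sum>\<phi>\<in>E1 i1. \<Sum>\<psi>\<in>E2 i2.
      {#(p (i1 + 1) / p i1 * a1 i1 \<phi> + p i1 / p (i1 - 1) * b1 i1 \<phi>)
        + (q (i2 + 1) / q i2 * a2 i2 \<psi> + q i2 / q (i2 - 1) * b2 i2 \<psi>)#})"
proof -
  define D where "D = {(i1, i2). -1 \<le> i1 \<and> -1 \<le> i2 \<and> i1 + i2 + 1 = i}"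
  define x1 where "x1 i1 \<phi> = p (i1 + 1) / p i1 * a1 i1 \<phi> + p i1 / p (i1 - 1) * b1 i1 \<phi>" for i1 \<phi>
  define x2 where "x2 i2 \<psi> = q (i2 + 1) / q i2 * a2 i2 \<psi> + q i2 / q (i2 - 1) * b2 i2 \<psi>" for i2 \<psi>
  \<comment> \<open>The index keeps the degrees, since the eigenvalues depend on them.\<close>
  define I where "I = Sigma D (\<lambda>(i1, i2). E1 i1 \<times> E2 i2)"
  define c :: "(int \<times> int) \<times> ('a set \<Rightarrow> real) \<times> ('b set \<Rightarrow> real) \<Rightarrow> ('a + 'b) set \<Rightarrow> real"
    where "c = (\<lambda>(_, \<phi>, \<psi>). tensor \<phi> \<psi>)"
  define e where "e = (\<lambda>((i1, i2), \<phi>, \<psi>). x1 i1 \<phi> + x2 i2 \<psi>)"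
  have "D \<subseteq> {-1..i + 1} \<times> {-1..i + 1}" by (auto simp: D_def)
  then have finD: "finite D" by (rule finite_subset) simp
  have finE: "finite (E1 j)" "finite (E2 j)" for j
    using E1 E2 by (auto simp: face_eigenbasis_def)
  have E1ff: "\<phi> \<in> face_functions K1 j" if "\<phi> \<in> E1 j" for \<phi> j
    using E1 that unfolding face_eigenbasis_def by blast
  have E2ff: "\<psi> \<in> face_functions K2 j" if "\<psi> \<in> E2 j" for \<psi> j
    using E2 that unfolding face_eigenbasis_def by blast
  have pos1: "0 < face_form K1 w1 \<phi> \<phi>" if "\<phi> \<in> E1 j" for \<phi> j
    using E1 that unfolding face_eigenbasis_def by blast
  have pos2: "0 < face_form K2 w2 \<psi> \<psi>" if "\<psi> \<in> E2 j" for \<psi> j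
    using E2 that unfolding face_eigenbasis_def by blast
  have orth1: "face_form K1 w1 \<phi> \<phi>' = 0" if "\<phi> \<in> E1 j" "\<phi>' \<in> E1 k" "j \<noteq> k \<or> \<phi> \<noteq> \<phi>'" for \<phi> \<phi>' j k
    using E1[of j] that face_form_disjoint_degrees[OF E1ff E1ff, of \<phi> j \<phi>' k w1]
    unfolding face_eigenbasis_def by blast
  have orth2: "face_form K2 w2 \<psi> \<psi>' = 0" if "\<psi> \<in> E2 j" "\<psi>' \<in> E2 k" "j \<noteq> k \<or> \<psi> \<noteq> \<psi>'" for \<psi> \<psi>' j k
    using E2[of j] that face_form_disjoint_degrees[OF E2ff E2ff, of \<psi> j \<psi>' k w2]
    unfolding face_eigenbasis_def by blast
  note form = face_form_tensor[OF K1.finite_complex K2.finite_complex, of w1 w2]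
  have "lap_eigs J w i = image_mset e (mset_set I)"
    unfolding J.eigs_face_functions
  proof (rule face_form.eigenvalue_mset_orthogonal[where K = J and w = "tensor w1 w2" and c = c])
    show "finite I"
      using finD finE by (auto simp: I_def)
    show "face_form J (tensor w1 w2) (c z) (c z) \<noteq> 0" if "z \<in> I" for z
      using that pos1 pos2 by (fastforce simp: I_def c_def form)
    show "face_form J (tensor w1 w2) (c z) (c z') = 0" if "z \<in> I" "z' \<in> I" "z \<noteq> z'" for z z'
    proof -
      obtain i1 i2 \<phi> \<psi> where z: "z = ((i1, i2), \<phi>, \<psi>)" by (metis prod.exhaust)
      obtain j1 j2 \<phi>' \<psi>' where z': "z' = ((j1, j2), \<phi>', \<psi>')" by (metis prod.exhaust)
      have "face_form K1 w1 \<phi> \<phi>' = 0 \<or> face_form K2 w2 \<psi> \<psi>' = 0"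
        using that orth1[of \<phi> i1 \<phi>' j1] orth2[of \<psi> i2 \<psi>' j2] by (auto simp: z z' I_def)
      then show ?thesis by (auto simp: z z' c_def form)
    qed
    show "span (c ` I) = face_functions J i"
    proof
      show "span (c ` I) \<subseteq> face_functions J i"
      proof (rule span_minimal[OF _ subspace_face_functions])
        show "c ` I \<subseteq> face_functions J i"
          using tensor_closed[OF E1ff E2ff] by (fastforce simp: I_def D_def c_def)
      qed
      show "face_functions J i \<subseteq> span (c ` I)"
      proof (rule face_functions_join_subset)
        fix i1 i2 \<phi> \<psi> assume i: "-1 \<le> i1" "-1 \<le> i2" "i1 + i2 + 1 = i"
          and "\<phi> \<in> face_functions K1 i1" "\<psi> \<in> face_functions K2 i2"
        then have \<phi>: "\<phi> \<in> span (E1 i1)" and \<psi>: "\<psi> \<in> span (E2 i2)"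
          using E1 E2 by (auto simp: face_eigenbasis_def)
        have "tensor \<phi>' \<psi>' \<in> c ` I" if "\<phi>' \<in> E1 i1" "\<psi>' \<in> E2 i2" for \<phi>' \<psi>'
          using that i by (force simp: c_def I_def D_def image_iff)
        \<comment> \<open>Bilinearity is used one argument at a time: the second is extended from
          \<open>E2 i2\<close> to its span, and after that the first.\<close>
        then have "tensor \<phi>' ` E2 i2 \<subseteq> span (c ` I)" if "\<phi>' \<in> E1 i1" for \<phi>'
          using that by (auto intro: span_base)
        then have "tensor \<phi>' ` span (E2 i2) \<subseteq> span (c ` I)" if "\<phi>' \<in> E1 i1" for \<phi>'
          unfolding linear_span_image[OF linear_tensor(2), symmetric]
          using that by (intro span_minimal) auto
        then have "(\<lambda>\<phi>'. tensor \<phi>' \<psi>) ` E1 i1 \<subseteq> span (c ` I)"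
          using \<psi> by auto
        then have "(\<lambda>\<phi>'. tensor \<phi>' \<psi>) ` span (E1 i1) \<subseteq> span (c ` I)"
          unfolding linear_span_image[OF linear_tensor(1), symmetric]
          by (intro span_minimal) auto
        then show "tensor \<phi> \<psi> \<in> span (c ` I)" using \<phi> by auto
      qed
    qed
    show "linear (\<lambda>f. J.face_lap_up f + J.face_lap_down f)"
      by (rule J.linear_face_laps)
    show "J.face_lap_up (c z) + J.face_lap_down (c z) = e z *\<^sub>R c z" if "z \<in> I" for z
    proof -
      obtain i1 i2 \<phi> \<psi> where z: "z = ((i1, i2), \<phi>, \<psi>)" by (metis prod.exhaust)
      then have \<phi>: "\<phi> \<in> E1 i1" and \<psi>: "\<psi> \<in> E2 i2" using that by (auto simp: I_def)
      have eig: "K1.face_lap_up \<phi> = a1 i1 \<phi> *\<^sub>R \<phi>" "K1.face_lap_down \<phi> = b1 i1 \<phi> *\<^sub>R \<phi>"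
        "K2.face_lap_up \<psi> = a2 i2 \<psi> *\<^sub>R \<psi>" "K2.face_lap_down \<psi> = b2 i2 \<psi> *\<^sub>R \<psi>"
        using E1 E2 \<phi> \<psi> unfolding face_eigenbasis_def by blast+
      show ?thesis
        by (simp add: z c_def e_def x1_def x2_def face_lap_tensor[OF E1ff[OF \<phi>] E2ff[OF \<psi>]] eig
            tensor_simps scaleR_add_left)
    qed
  qed
  also have "\<dots> = (\<Sum>d\<in>D. \<Sum>z\<in>(case d of (i1, i2) \<Rightarrow> E1 i1 \<times> E2 i2). {#e (d, z)#})"
    unfolding image_mset_mset_set I_def using finD finE by (subst sum.Sigma) auto
  also have "\<dots> = (\<Sum>(i1, i2)\<in>D. \<Sum>\<phi>\<in>E1 i1. \<Sum>\<psi>\<in>E2 i2. {#x1 i1 \<phi> + x2 i2 \<psi>#})"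
    by (rule sum.cong) (auto simp: sum.cartesian_product e_def case_prod_unfold)
  finally show ?thesis unfolding D_def x1_def x2_def .
qed

text \<open>Here too zero eigenvalues are included: a zero in one factor contributes 0 to the sum
  whatever its factor is.\<close>

lemma lap_eigs_join_factored:
  "lap_eigs J w i =
    (\<Sum>(i1, i2)\<in>{(i1, i2). -1 \<le> i1 \<and> -1 \<le> i2 \<and> i1 + i2 + 1 = i}.
       \<Sum>(l, P)\<in>#factored_eigs p K1 w1 i1. \<Sum>(m, Q)\<in>#factored_eigs q K2 w2 i2. {#P * l + Q * m#})"
proof -
  obtain E1 a1 b1 where E1: "\<And>i. face_eigenbasis K1 w1 r1 i (E1 i) (a1 i) (b1 i)"
    using K1.ex_face_eigenbasis by metis
  obtain E2 a2 b2 where E2: "\<And>i. face_eigenbasis K2 w2 r2 i (E2 i) (a2 i) (b2 i)"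
    using K2.ex_face_eigenbasis by metis
  define x1 where "x1 i1 \<phi> = p (i1 + 1) / p i1 * a1 i1 \<phi> + p i1 / p (i1 - 1) * b1 i1 \<phi>" for i1 \<phi>
  define x2 where "x2 i2 \<psi> = q (i2 + 1) / q i2 * a2 i2 \<psi> + q i2 / q (i2 - 1) * b2 i2 \<psi>" for i2 \<psi>
  have inner: "(\<Sum>(m, Q)\<in>#factored_eigs q K2 w2 i2. {#y + Q * m#}) = (\<Sum>\<psi>\<in>E2 i2. {#y + x2 i2 \<psi>#})"
    for y i2
    using sum_mset_image_prod[OF K2.factored_eigs_eigenbasis[OF E2], where g = "\<lambda>z. {#y + z#}"]
    by (simp add: x2_def)
  have outer: "(\<Sum>(l, P)\<in>#factored_eigs p K1 w1 i1. \<Sum>\<psi>\<in>E2 i2. {#P * l + x2 i2 \<psi>#})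
      = (\<Sum>\<phi>\<in>E1 i1. \<Sum>\<psi>\<in>E2 i2. {#x1 i1 \<phi> + x2 i2 \<psi>#})" for i1 i2
    using sum_mset_image_prod[OF K1.factored_eigs_eigenbasis[OF E1],
        where g = "\<lambda>z. \<Sum>\<psi>\<in>E2 i2. {#z + x2 i2 \<psi>#}"]
    by (simp add: x1_def)
  show ?thesis
    unfolding lap_eigs_join[OF E1 E2] inner outer by (simp add: x1_def x2_def)
qed

end

theorem theorem6p5:
  fixes K1 :: "'a set set" and K2 :: "'b set set"
    and w1 :: "'a set \<Rightarrow> real" and w2 :: "'b set \<Rightarrow> real" and w :: "('a + 'b) set \<Rightarrow> real"
    and p q :: "int \<Rightarrow> real" and i :: int
  assumes "abstract_complex K1" and "abstract_complex K2"
    and "weight_function K1 w1" and "weight_function K2 w2"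
    and "\<forall>j\<in>{-1..complex_dim K1}. 0 < p j"
    and "\<forall>j\<in>{-1..complex_dim K2}. 0 < q j"
    and "\<forall>F1\<in>K1. \<forall>F2\<in>K2. w (F1 <+> F2) = p (face_dim F1) * w1 F1 * q (face_dim F2) * w2 F2"
    and "-1 \<le> i"
  shows "filter_mset (\<lambda>x. x \<noteq> 0) (lap_eigs (simplicial_join K1 K2) w i) =
         filter_mset (\<lambda>x. x \<noteq> 0)
           (\<Sum>(i1, i2)\<in>{(i1, i2). -1 \<le> i1 \<and> -1 \<le> i2 \<and> i1 + i2 + 1 = i}.
              \<Sum>(l, P)\<in>#factored_eigs p K1 w1 i1.
                \<Sum>(m, Q)\<in>#factored_eigs q K2 w2 i2. {#P * l + Q * m#})"
proof -
  obtain r1 :: "'a \<Rightarrow> nat" where r1: "inj_on r1 (\<Union>K1)" using ex_rank[OF assms(1)] .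
  obtain r2 :: "'b \<Rightarrow> nat" where r2: "inj_on r2 (\<Union>K2)" using ex_rank[OF assms(2)] .
  have fin: "finite (r1 ` \<Union>K1)" using assms(1) by (auto simp: abstract_complex_def)
  \<comment> \<open>The shift exceeds every rank in \<open>K1\<close>. If \<open>K1\<close> has only
    the empty face, \<open>Max\<close> is taken of the empty set, but then there is no vertex to
    bound.\<close>
  interpret ranked_join K1 w1 r1 K2 w2 r2 w p q "Suc (Max (r1 ` \<Union>K1))"
  proof
    show "r1 v < Suc (Max (r1 ` \<Union>K1))" if "v \<in> \<Union>K1" for v
      using Max_ge[OF fin imageI[OF that]] by simp
    show "0 < p (face_dim F)" if "F \<in> K1" for F
      using assms(5) face_dim_mem[OF assms(1) that] by blast
    show "0 < q (face_dim F)" if "F \<in> K2" for F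
      using assms(6) face_dim_mem[OF assms(2) that] by blast
  qed (use assms r1 r2 in auto)
  show ?thesis by (simp only: lap_eigs_join_factored)
qed

end
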